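(* Let $d\ge 1$, $a,w_1,\dots,w_d\in\mathcal H$, $\bm w=(w_1,\dots,w_d)$, and let $q\in\{1,\dots,d\}$. Then $$\begin{aligned} F.P.[\zeta_{\rm B}(\alpha,a|\bm w)]_{\alpha=q}={}&\lim_{M\to\infty}\Biggl[\frac{(-1)^q}{(q-1)!}\sum_{m=0}^{d-q}\frac{{}_dS_m^{(d)}(0)}{m!\,(d-q-m)!}F\bigl[(a+x)^{d-q-m}\log(a+x)\bigr]_{x=M\bm w}\\ &\qquad+\sum_{\bm n\in\mathcal C_{M-1}}(a+\bm n\cdot\bm w)^{-q}\Biggr]\\ &+\frac{(-1)^{d-q+1}}{(q-1)!}\sum_{m=0}^{d-q}\frac{{}_dS_m^{(d)}(0)\,a^{d-q-m}}{m!\,(d-q-m)!}\bigl(H_{q-1}-H_{d-q-m}\bigr), \end{aligned}$$ where the limit is over positive integers $M$.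
   Context: $\mathcal H=\{z\in\mathbb C:\theta-\frac{\pi}{2}<\arg z<\theta+\frac{\pi}{2}\}$ is a fixed open half-plane ($\theta$ a fixed real angle), and $\log$ is a fixed holomorphic branch of the logarithm on $\mathcal H$; $z^s=\exp(s\log z)$ for $z\in\mathcal H$. $\mathbb N_0=\{0,1,2,\dots\}$, $\bm n\cdot\bm w=\sum_{i=1}^d n_iw_i$, and $\mathcal C_M=\{0,1,\dots,M\}^d$. The Barnes zeta function is $\zeta_{\rm B}(\alpha,a|\bm w)=\sum_{\bm n\in\mathbb N_0^d}(a+\bm n\cdot\bm w)^{-\alpha}$ for $\Re(\alpha)>d$; it extends meromorphically in $\alpha$ to $\mathbb C$, with at most simple poles, located at $\alpha=1,\dots,d$. $F.P.[f(\alpha)]_{\alpha=q}$ denotes the constant term of the Laurent expansion of $f$ at $\alpha=q$. For $\bm v\in\mathbb C^d$ and a function $g$ of $x$, $F[g(x)]_{x=\bm v}=\sum_{\emptyset\ne S\subseteq\{1,\dots,d\}}(-1)^{d-|S|}g\bigl(\sum_{i\in S}v_i\bigr)$. Harmonic numbers: $H_k=\sum_{i=1}^k 1/i$, $H_0=0$. The higher order Bernoulli polynomials $B_n(a|\bm w)$ are defined by $z^d{\rm e}^{az}\prod_{i=1}^d\frac{w_i}{{\rm e}^{w_iz}-1}=\sum_{n\ge0}B_n(a|\bm w)\frac{z^n}{n!}$ for $|z|<2\pi/\max_i|w_i|$. The Bernoullian functions ${}_dS_n(a)$ ($n\ge0$; dependence on $\bm w$ suppressed) are the polynomials in $a$ with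 ${}_dS_n(0)=0$ and ${}_dS_n'(a)=\frac{n!}{(n+d-1)!\,\prod_{i=1}^dw_i}B_{n+d-1}(a|\bm w)$; ${}_dS_m^{(d)}(0)$ is the $d$-th derivative in $a$ at $a=0$ (equivalently ${}_dS_m^{(d)}(0)=B_m(0|\bm w)/\prod_{i=1}^dw_i$). *)

theory Defs
  imports "HOL-Complex_Analysis.Complex_Analysis"
begin

definition half_plane :: "real \<Rightarrow> complex set" where
  "half_plane \<theta> = {of_real r * cis \<phi> | r \<phi>. 0 < r \<and> \<theta> - pi / 2 < \<phi> \<and> \<phi> < \<theta> + pi / 2}"

definition log_branch :: "(complex \<Rightarrow> complex) \<Rightarrow> real \<Rightarrow> bool" where
  "log_branch L \<theta> \<longleftrightarrow>
     L holomorphic_on half_plane \<theta> \<and> (\<forall>z\<in>half_plane \<theta>. exp (L z) = z)"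

definition branch_power :: "(complex \<Rightarrow> complex) \<Rightarrow> complex \<Rightarrow> complex \<Rightarrow> complex" where
  "branch_power L z s = exp (s * L z)"

text \<open>
  A vector of length \<open>d\<close> is a function on \<open>nat\<close> of which only the values at \<open>1, \<dots>, d\<close> are used;
  a multi-index is an element of a \<^const>\<open>PiE\<close> over \<open>{1..d}\<close>, so that its values elsewhere are fixed.
\<close>

definition multi_dot :: "nat \<Rightarrow> (nat \<Rightarrow> nat) \<Rightarrow> (nat \<Rightarrow> complex) \<Rightarrow> complex" where
  "multi_dot d n w = (\<Sum>i=1..d. of_nat (n i) * w i)"

definition multi_indices :: "nat \<Rightarrow> (nat \<Rightarrow> nat) set" where
  "multi_indices d = PiE {1..d} (\<lambda>_. UNIV)"

definition cube :: "nat \<Rightarrow> nat \<Rightarrow> (nat \<Rightarrow> nat) set" where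
  "cube d M = PiE {1..d} (\<lambda>_. {0..M})"

text \<open>
  The meromorphic continuation of the series to the whole plane. The identity theorem determines it
  up to the values at removable singularities and poles; \<^const>\<open>nicely_meromorphic_on\<close> fixes those
  as well (limit value, respectively 0 at a pole).
\<close>

definition barnes_zeta ::
    "nat \<Rightarrow> (nat \<Rightarrow> complex) \<Rightarrow> (complex \<Rightarrow> complex) \<Rightarrow> complex \<Rightarrow> complex \<Rightarrow> complex" where
  "barnes_zeta d w L a =
     (THE f. f nicely_meromorphic_on UNIV \<and>
        (\<forall>\<alpha>. Re \<alpha> > of_nat d \<longrightarrow>
           ((\<lambda>n. branch_power L (a + multi_dot d n w) (- \<alpha>)) has_sum f \<alpha>) (multi_indices d)))"

definition finite_part :: "(complex \<Rightarrow> complex) \<Rightarrow> complex \<Rightarrow> complex" where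
  "finite_part f q = fls_nth (laurent_expansion f q) 0"

definition alt_subset_sum :: "nat \<Rightarrow> (complex \<Rightarrow> complex) \<Rightarrow> (nat \<Rightarrow> complex) \<Rightarrow> complex" where
  "alt_subset_sum d g v =
     (\<Sum>S | S \<subseteq> {1..d} \<and> S \<noteq> {}. (- 1) ^ (d - card S) * g (\<Sum>i\<in>S. v i))"

text \<open>
  The generating function has a removable singularity at \<open>0\<close> (where the expression itself evaluates
  through division by zero); its Laurent expansion there is the Taylor series of the extended function.
\<close>

definition bernoulli_higher :: "nat \<Rightarrow> (nat \<Rightarrow> complex) \<Rightarrow> nat \<Rightarrow> complex \<Rightarrow> complex" where
  "bernoulli_higher d w n a =
     fact n * fls_nth (laurent_expansion
       (\<lambda>z. z ^ d * exp (a * z) * (\<Prod>i=1..d. w i / (exp (w i * z) - 1))) 0) (int n)"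

definition bernoullian :: "nat \<Rightarrow> (nat \<Rightarrow> complex) \<Rightarrow> nat \<Rightarrow> complex poly" where
  "bernoullian d w n =
     (THE p. poly p 0 = 0 \<and>
        (\<forall>a. poly (pderiv p) a =
           fact n / (fact (n + d - 1) * (\<Prod>i=1..d. w i)) * bernoulli_higher d w (n + d - 1) a))"

definition bernoullian_deriv0 :: "nat \<Rightarrow> (nat \<Rightarrow> complex) \<Rightarrow> nat \<Rightarrow> complex" where
  "bernoullian_deriv0 d w m = poly ((pderiv ^^ d) (bernoullian d w m)) 0"

end

theory Submission
  imports Defs
begin

text \<open>
  Let \<open>T\<^sub>v\<close> be translation by \<open>v\<close>. The symbol \<open>\<Prod>(1 - exp (w\<^sub>i z))\<close> of \<open>\<Prod>(1 - T\<^bsub>w\<^sub>i\<^esub>)\<close> has the inverse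
  \<open>\<Sum> c\<^sub>m z\<^bsup>m - d\<^esup>\<close>, where the \<open>c\<^sub>m\<close> are Bernoulli numbers of order \<open>d\<close> up to factors. Applying the first
  \<open>N\<close> terms of this inverse to \<open>x\<^bsup>-\<alpha>\<^esup>\<close> therefore gives a function \<open>P\<close>, elementary and meromorphic in \<open>\<alpha>\<close>, with
  \<open>x\<^bsup>-\<alpha>\<^esup> - \<Prod>(1 - T\<^bsub>w\<^sub>i\<^esub>) P = O(\<bar>x\<bar>\<^bsup>- Re \<alpha> - N\<^esup>)\<close> by Taylor's theorem. Sums of \<open>\<Prod>(1 - T\<^bsub>w\<^sub>i\<^esub>) P\<close>
  over cubes telescope to alternating sums of \<open>P\<close> over corners, so \<open>P a\<close> plus the convergent sum of the
  errors continues the zeta function to \<open>Re \<alpha> > d - N\<close>, and it is the locally uniform limit of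
  \<open>\<Sum> (a + n \<cdot> w)\<^bsup>-\<alpha>\<^esup>\<close> over cubes minus the values of \<open>P\<close> at the corners other than \<open>a\<close>. After
  multiplication by \<open>\<alpha> - q\<close> the derivatives at \<open>q\<close> converge as well; they are the expressions in the
  theorem. The terms with harmonic numbers at the corners collapse to the corner \<open>a\<close>, because \<open>d\<close>-fold
  differences kill polynomials of degree less than \<open>d\<close>.
\<close>

section \<open>Exponential generating functions and Bernoulli polynomials\<close>

lemma fps_exp_sum:
  fixes v :: "'b \<Rightarrow> 'a :: field_char_0"
  shows "fps_exp (\<Sum>i\<in>S. v i) = (\<Prod>i\<in>S. fps_exp (v i))"
  by (induction S rule: infinite_finite_induct) (auto simp: fps_exp_add_mult)

text \<open>The series (e^(wz) - 1)/z. Its constant term is w, so it is invertible for w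
  nonzero.\<close>

definition fps_exp_quot :: "complex \<Rightarrow> complex fps" where
  "fps_exp_quot w = fps_shift 1 (fps_exp w - 1)"

lemma fps_X_mult_exp_quot: "fps_X * fps_exp_quot w = fps_exp w - 1"
  by (rule fps_ext) (auto simp: fps_exp_quot_def fps_X_mult_nth)

lemma fps_exp_quot_nth_0 [simp]: "fps_nth (fps_exp_quot w) 0 = w"
  by (simp add: fps_exp_quot_def)

text \<open>Expansion of the product over subsets. Its coefficient of z^p is, up to p!, the
  alternating sum of p-th powers over the corners x + \<Sum> v_i of a parallelepiped.\<close>

lemma alternating_fps_exp_sum:
  fixes v :: "'b \<Rightarrow> complex"
  assumes "finite I"
  shows "(\<Sum>S\<in>Pow I. (- 1) ^ card S * fps_exp (x + (\<Sum>i\<in>S. v i))) =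
           fps_exp x * (\<Prod>i\<in>I. 1 - fps_exp (v i))"
  using assms
  by (subst prod_diff_conv_sum)
     (simp_all add: fps_exp_add_mult fps_exp_sum sum_distrib_left mult_ac)

lemma alternating_fps_exp_sum_nth:
  fixes h :: "'b \<Rightarrow> complex"
  shows "fps_nth (\<Sum>S\<in>J. (- 1) ^ f S * fps_exp (h S)) p = (\<Sum>S\<in>J. (- 1) ^ f S * h S ^ p) / fact p"
proof -
  have "fps_nth ((- 1) ^ n * F) p = (- 1) ^ n * fps_nth F p" for n and F :: "complex fps"
    by (cases "even n") auto
  note * = this
  show ?thesis
    unfolding fps_sum_nth * by (simp add: sum_divide_distrib)
qed

text \<open>Each factor 1 - e^(v_i z) is divisible by z, so the product has no coefficient below
  degree \<open>card I\<close>: an iterated difference kills polynomials of smaller degree.\<close>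

lemma alternating_power_sum_eq_0:
  fixes v :: "'b \<Rightarrow> complex"
  assumes "finite I" "p < card I"
  shows "(\<Sum>S\<in>Pow I. (- 1) ^ card S * (x + (\<Sum>i\<in>S. v i)) ^ p) = 0"
proof -
  have "(\<Prod>i\<in>I. 1 - fps_exp (v i)) = fps_X ^ card I * (\<Prod>i\<in>I. - fps_exp_quot (v i))"
    by (simp flip: prod.distrib prod_constant add: fps_X_mult_exp_quot)
  hence "fps_nth (\<Sum>S\<in>Pow I. (- 1) ^ card S * fps_exp (x + (\<Sum>i\<in>S. v i))) p = 
         fps_nth (fps_X ^ card I * (fps_exp x * (\<Prod>i\<in>I. - fps_exp_quot (v i)))) p"
    using alternating_fps_exp_sum[OF assms(1), of x v] by (simp add: mult_ac)
  also have "\<dots> = 0"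
    using assms(2) by (simp add: fps_X_power_mult_nth)
  finally show ?thesis
    by (simp add: alternating_fps_exp_sum_nth)
qed

text \<open>The series \<Prod> w_i z/(e^(w_i z) - 1) with coefficients B_n(0|w)/n!. The factors z
  are absorbed in \<open>fps_exp_quot\<close>, so no Laurent series is needed.\<close>

definition bernoulli_fps :: "nat \<Rightarrow> (nat \<Rightarrow> complex) \<Rightarrow> complex fps" where
  "bernoulli_fps d w = (\<Prod>i=1..d. fps_const (w i) * inverse (fps_exp_quot (w i)))"

lemma bernoulli_fps_mult:
  assumes "\<And>i. i \<in> {1..d} \<Longrightarrow> w i \<noteq> 0"
  shows "bernoulli_fps d w * (\<Prod>i=1..d. 1 - fps_exp (w i)) =
           fps_const ((- 1) ^ d * (\<Prod>i=1..d. w i)) * fps_X ^ d"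
proof -
  have const_prod: "(\<Prod>i\<in>J. fps_const (f i)) = fps_const (\<Prod>i\<in>J. f i)" 
    for J and f :: "nat \<Rightarrow> complex"
    by (induction J rule: infinite_finite_induct) auto
  have "bernoulli_fps d w * (\<Prod>i=1..d. 1 - fps_exp (w i)) =
          (\<Prod>i=1..d. fps_const (- w i) * fps_X * (fps_exp_quot (w i) * inverse (fps_exp_quot (w i))))"
    unfolding bernoulli_fps_def prod.distrib[symmetric]
  proof (rule prod.cong[OF refl], goal_cases)
    case (1 i)
    have "1 - fps_exp (w i) = - (fps_X * fps_exp_quot (w i))"
      by (simp add: fps_X_mult_exp_quot)
    thus ?case by (simp add: mult_ac flip: fps_const_neg)
  qed
  also have "\<dots> = (\<Prod>i=1..d. fps_const (- w i) * fps_X)"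
    by (rule prod.cong[OF refl]) (use assms in \<open>auto simp: inverse_mult_eq_1'\<close>)
  also have "\<dots> = fps_const (\<Prod>i=1..d. - w i) * fps_X ^ d"
    by (simp add: prod.distrib const_prod del: fps_const_neg)
  finally show ?thesis by (simp add: prod_uminus)
qed

text \<open>Distributing z^d as one factor z to each of the d quotients cancels every simple pole at
  0, and the Laurent expansion becomes a power series.\<close>

lemma bernoulli_higher_conv_fps:
  assumes "\<And>i. i \<in> {1..d} \<Longrightarrow> w i \<noteq> 0"
  shows "bernoulli_higher d w n a = fact n * fps_nth (fps_exp a * bernoulli_fps d w) n"
proof -
  have fls_prod: "fps_to_fls (prod f J) = (\<Prod>i\<in>J. fps_to_fls (f i))" 
    for f :: "nat \<Rightarrow> complex fps" and J
    by (induction J rule: infinite_finite_induct) (auto simp: fls_times_fps_to_fls)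
  have "(\<lambda>z. z ^ d * exp (a * z) * (\<Prod>i=1..d. w i / (exp (w i * z) - 1))) has_laurent_expansion
          fls_X ^ d * fps_to_fls (fps_exp a) * (\<Prod>i=1..d. fls_const (w i) / (fps_to_fls (fps_exp (w i)) - 1))"
    by (intro laurent_expansion_intros has_laurent_expansion_fps has_fps_expansion_exp)
  also have "fls_X ^ d * fps_to_fls (fps_exp a) * (\<Prod>i=1..d. fls_const (w i) / (fps_to_fls (fps_exp (w i)) - 1)) =
        fps_to_fls (fps_exp a) * (\<Prod>i=1..d. fls_X * (fls_const (w i) / (fps_to_fls (fps_exp (w i)) - 1)))"
    by (simp add: prod.distrib del: times_divide_eq_right)
  also have "(\<Prod>i=1..d. fls_X * (fls_const (w i) / (fps_to_fls (fps_exp (w i)) - 1))) =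
        (\<Prod>i=1..d. fps_to_fls (fps_const (w i) * inverse (fps_exp_quot (w i))))"
  proof (rule prod.cong[OF refl], goal_cases)
    case (1 i)
    have nz: "fps_exp_quot (w i) \<noteq> 0"
      using assms[OF 1] fps_exp_quot_nth_0[of "w i"] by (metis fps_zero_nth)
    have "fps_to_fls (fps_exp (w i)) - 1 = fps_to_fls (fps_X * fps_exp_quot (w i))"
      by (simp add: fps_X_mult_exp_quot)
    also have "\<dots> = fls_X * fps_to_fls (fps_exp_quot (w i))"
      by (simp add: fls_times_fps_to_fls)
    finally have *: "fps_to_fls (fps_exp (w i)) - 1 = fls_X * fps_to_fls (fps_exp_quot (w i))" .
    have "fps_to_fls (inverse (fps_exp_quot (w i))) = inverse (fps_to_fls (fps_exp_quot (w i)))"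
      using assms[OF 1] by (subst fls_inverse_fps_to_fls) auto
    thus ?case unfolding * using nz
      by (simp add: fls_times_fps_to_fls field_simps)
  qed
  also have "fps_to_fls (fps_exp a) * \<dots> = fps_to_fls (fps_exp a * bernoulli_fps d w)"
    by (simp add: bernoulli_fps_def fls_prod fls_times_fps_to_fls)
  finally show ?thesis
    unfolding bernoulli_higher_def by (subst laurent_expansion_0_eqI) auto
qed

text \<open>The coefficient of degree d is 1/d times that of degree d - 1 in the prescribed
  derivative. The latter is read off the Cauchy product of e^(az) with \<open>bernoulli_fps\<close>,
  where a^(d-1) meets the coefficient of index n.\<close>

lemma coeff_bernoullian:
  assumes "\<And>i. i \<in> {1..d} \<Longrightarrow> w i \<noteq> 0" and "d \<ge> 1"
  shows "coeff (bernoullian d w n) d =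
           fact n * fps_nth (bernoulli_fps d w) n / (fact d * (\<Prod>i=1..d. w i))"
proof -
  define N where "N = n + d - 1"
  define C where "C = fact n / (fact N * (\<Prod>i=1..d. w i))"
  \<comment> \<open>\<open>Q\<close> is the prescribed derivative as an explicit polynomial in a,
    and \<open>p0\<close> its antiderivative without constant term: the witness for the definite
    description.\<close>
  define Q where "Q = (\<Sum>k\<le>N. monom (C * fact N * fps_nth (bernoulli_fps d w) (N - k) / fact k) k)"
  define p0 where "p0 = (\<Sum>k\<le>N. monom (coeff Q k / of_nat (Suc k)) (Suc k))"
  have poly_Q: "poly Q a = C * bernoulli_higher d w N a" for a
    by (subst bernoulli_higher_conv_fps)
       (use assms(1) in \<open>auto simp: fps_mult_nth Q_def poly_sum poly_monom
              sum_distrib_left atLeast0AtMost intro!: sum.cong\<close>)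
  have coeff_Q: "coeff Q k = 0" if "k > N" for k
    using that by (auto simp: Q_def coeff_sum intro!: sum.neutral)
  have "pderiv p0 = Q"
  proof (rule poly_eqI)
    fix k show "coeff (pderiv p0) k = coeff Q k"
    proof (cases "k \<le> N")
      case True
      have "coeff p0 (Suc k) = (\<Sum>j\<le>N. if j = k then coeff Q k / of_nat (Suc k) else 0)"
        unfolding p0_def coeff_sum by (intro sum.cong) auto
      thus ?thesis using True by (simp add: coeff_pderiv del: of_nat_Suc)
    next
      case False
      have "coeff p0 (Suc k) = 0" 
        using False unfolding p0_def coeff_sum by (intro sum.neutral) auto
      thus ?thesis using False by (simp add: coeff_pderiv coeff_Q)
    qed
  qed
  moreover have "poly p0 0 = 0"
    by (simp add: p0_def poly_sum poly_monom)
  ultimately have p0: "poly p0 0 = 0 \<and> (\<forall>a. poly (pderiv p0) a = C * bernoulli_higher d w N a)"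
    by (simp add: poly_Q)
  have "bernoullian d w n = p0"
    unfolding bernoullian_def N_def[symmetric] C_def[symmetric]
  proof (rule the_equality[where P = "\<lambda>p. poly p 0 = 0 \<and> (\<forall>a. poly (pderiv p) a = C * bernoulli_higher d w N a)", OF p0])
    fix p assume p: "poly p 0 = 0 \<and> (\<forall>a. poly (pderiv p) a = C * bernoulli_higher d w N a)"
    have "pderiv p = pderiv p0"
      by (subst poly_eq_poly_eq_iff[symmetric]) (use p p0 in auto)
    hence "pderiv (p - p0) = 0" by (simp add: pderiv_diff)
    then obtain h where "p - p0 = [:h:]"
      using pderiv_iszero by blast
    moreover have "poly (p - p0) 0 = 0" using p p0 by simp
    ultimately show "p = p0" by simp
  qed
  moreover have "of_nat d * coeff p0 d = coeff Q (d - 1)"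
    using coeff_pderiv[of p0 "d - 1"] \<open>pderiv p0 = Q\<close> assms(2) by (simp add: of_nat_diff)
  moreover have "coeff Q (d - 1) = C * fact N * fps_nth (bernoulli_fps d w) n / fact (d - 1)"
  proof -
    have "coeff Q (d - 1) = (\<Sum>k\<le>N. if k = d - 1 then 
            C * fact N * fps_nth (bernoulli_fps d w) (N - (d - 1)) / fact (d - 1) else 0)"
      unfolding Q_def coeff_sum by (intro sum.cong) auto
    thus ?thesis using assms(2) by (simp add: N_def)
  qed
  ultimately have "of_nat d * coeff (bernoullian d w n) d = C * fact N * fps_nth (bernoulli_fps d w) n / fact (d - 1)"
    by simp
  moreover have "fact d = of_nat d * (fact (d - 1) :: complex)"
    using assms(2) by (simp add: fact_reduce)
  moreover have "coeff (bernoullian d w n) d = of_nat d * coeff (bernoullian d w n) d / of_nat d"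
    using assms(2) by simp
  ultimately show ?thesis
    by (simp only:) (simp add: C_def mult_ac)
qed

lemma bernoullian_deriv0_conv_fps:
  assumes "\<And>i. i \<in> {1..d} \<Longrightarrow> w i \<noteq> 0" and "d \<ge> 1"
  shows "bernoullian_deriv0 d w m = fact m * fps_nth (bernoulli_fps d w) m / (\<Prod>i=1..d. w i)"
  unfolding bernoullian_deriv0_def poly_0_coeff_0 coeff_higher_pderiv
  by (subst add_0, subst coeff_bernoullian) (use assms in \<open>auto simp: pochhammer_fact[symmetric]\<close>)

section \<open>Half-planes and branches of the logarithm\<close>

text \<open>The signed distance from the boundary line of the half-plane. It is additive along
  lattice sums and bounds the modulus from below, so it replaces the modulus in all
  estimates.\<close>

definition half_plane_height :: "real \<Rightarrow> complex \<Rightarrow> real" where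
  "half_plane_height \<theta> z = Re (z * cis (- \<theta>))"

lemma half_plane_height_add:
  "half_plane_height \<theta> (x + y) = half_plane_height \<theta> x + half_plane_height \<theta> y"
  by (simp add: half_plane_height_def algebra_simps)

lemma half_plane_height_of_nat:
  "half_plane_height \<theta> (of_nat n * x) = of_nat n * half_plane_height \<theta> x"
  by (simp add: half_plane_height_def algebra_simps)

lemma half_plane_height_sum:
  "half_plane_height \<theta> (\<Sum>i\<in>S. f i) = (\<Sum>i\<in>S. half_plane_height \<theta> (f i))"
  by (simp add: half_plane_height_def algebra_simps sum_distrib_left sum_distrib_right)

lemma half_plane_height_le_norm: "half_plane_height \<theta> z \<le> norm z"
  unfolding half_plane_height_def
  by (rule order.trans[OF complex_Re_le_cmod]) (simp add: norm_mult)

text \<open>Rotation by -\<theta> carries the half-plane to Re u > 0, which is where the principal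
  argument lies strictly between -\<pi>/2 and \<pi>/2.\<close>

lemma half_plane_iff: "z \<in> half_plane \<theta> \<longleftrightarrow> half_plane_height \<theta> z > 0"
proof
  assume "z \<in> half_plane \<theta>"
  then obtain r \<phi> where *: "0 < r" "\<theta> - pi / 2 < \<phi>" "\<phi> < \<theta> + pi / 2" "z = of_real r * cis \<phi>"
    by (auto simp: half_plane_def)
  have "z * cis (- \<theta>) = of_real r * cis (\<phi> - \<theta>)"
    by (simp add: * cis_mult mult.assoc)
  hence "half_plane_height \<theta> z = r * cos (\<phi> - \<theta>)"
    by (simp add: half_plane_height_def)
  also have "\<dots> > 0"
    using * by (intro mult_pos_pos cos_gt_zero_pi) auto
  finally show "half_plane_height \<theta> z > 0" .
next
  define u where "u = z * cis (- \<theta>)"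
  assume "half_plane_height \<theta> z > 0"
  hence u: "Re u > 0" by (simp add: half_plane_height_def u_def)
  hence "u \<noteq> 0" by auto
  have "z = u * cis \<theta>"
    by (simp add: u_def cis_mult mult.assoc)
  also have "u = exp (Ln u)" using \<open>u \<noteq> 0\<close> by simp
  also have "\<dots> * cis \<theta> = of_real (norm u) * cis (Im (Ln u) + \<theta>)"
    using \<open>u \<noteq> 0\<close> by (subst exp_eq_polar) (simp add: cis_mult mult.assoc)
  finally have "z = of_real (norm u) * cis (Im (Ln u) + \<theta>)" .
  moreover have "\<bar>Im (Ln u)\<bar> < pi / 2"
    using u Re_Ln_pos_lt[OF \<open>u \<noteq> 0\<close>] by blast
  ultimately show "z \<in> half_plane \<theta>"
    unfolding half_plane_def using \<open>u \<noteq> 0\<close>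
    by (intro CollectI exI[of _ "norm u"] exI[of _ "Im (Ln u) + \<theta>"]) auto
qed

lemma half_plane_nonzero: "z \<in> half_plane \<theta> \<Longrightarrow> z \<noteq> 0"
  by (auto simp: half_plane_iff half_plane_height_def)

lemma open_half_plane: "open (half_plane \<theta>)"
proof -
  have "half_plane \<theta> = {z. 0 < Re (z * cis (- \<theta>))}"
    by (auto simp: half_plane_iff half_plane_height_def)
  also have "open \<dots>"
    by (intro open_Collect_less continuous_intros)
  finally show ?thesis .
qed

lemma convex_half_plane_height_ge: "convex {z. half_plane_height \<theta> z \<ge> c}"
proof (rule convexI)
  fix x y u v assume *: "x \<in> {z. half_plane_height \<theta> z \<ge> c}" "y \<in> {z. half_plane_height \<theta> z \<ge> c}"
    "0 \<le> u" "0 \<le> v" "u + v = (1::real)"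
  have "half_plane_height \<theta> (u *\<^sub>R x + v *\<^sub>R y) = u * half_plane_height \<theta> x + v * half_plane_height \<theta> y"
    by (simp add: half_plane_height_def algebra_simps)
  also have "\<dots> \<ge> u * c + v * c"
    using * by (intro add_mono mult_left_mono) auto
  also have "u * c + v * c = c"
    using * by (simp flip: distrib_right)
  finally show "u *\<^sub>R x + v *\<^sub>R y \<in> {z. half_plane_height \<theta> z \<ge> c}" by simp
qed

lemma convex_half_plane: "convex (half_plane \<theta>)"
proof (rule convexI)
  fix x y u v assume *: "x \<in> half_plane \<theta>" "y \<in> half_plane \<theta>"
    "0 \<le> u" "0 \<le> v" "u + v = (1::real)"
  define c where "c = min (half_plane_height \<theta> x) (half_plane_height \<theta> y)"
  have "u *\<^sub>R x + v *\<^sub>R y \<in> {z. half_plane_height \<theta> z \<ge> c}"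
    by (rule convexD[OF convex_half_plane_height_ge]) (use * in \<open>auto simp: c_def\<close>)
  moreover have "c > 0" using * by (auto simp: c_def half_plane_iff)
  ultimately show "u *\<^sub>R x + v *\<^sub>R y \<in> half_plane \<theta>"
    by (auto simp: half_plane_iff)
qed

lemma half_plane_translate:
  assumes "x \<in> half_plane \<theta>" "half_plane_height \<theta> v \<ge> 0"
  shows "x + v \<in> half_plane \<theta>"
  using assms by (simp add: half_plane_iff half_plane_height_add)

lemma log_branch_exp: "log_branch L \<theta> \<Longrightarrow> z \<in> half_plane \<theta> \<Longrightarrow> exp (L z) = z"
  by (simp add: log_branch_def)

lemma log_branch_has_field_derivative:
  assumes "log_branch L \<theta>" "z \<in> half_plane \<theta>"
  shows "(L has_field_derivative 1 / z) (at z)"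
proof -
  have L: "(L has_field_derivative deriv L z) (at z)"
    using assms open_half_plane holomorphic_derivI unfolding log_branch_def by blast
  have "((\<lambda>z. exp (L z)) has_field_derivative exp (L z) * deriv L z) (at z)"
    by (auto intro!: derivative_eq_intros L)
  moreover have "((\<lambda>z. exp (L z)) has_field_derivative 1) (at z)"
    by (rule has_field_derivative_transform_within_open[OF DERIV_ident open_half_plane assms(2)])
       (simp add: log_branch_exp[OF assms(1)])
  ultimately have "exp (L z) * deriv L z = 1"
    using DERIV_unique by blast
  hence "deriv L z = 1 / z"
    using log_branch_exp[OF assms] half_plane_nonzero[OF assms(2)] by (simp add: field_simps)
  with L show ?thesis by (simp only:)
qed

lemma norm_eq_exp_Re_log_branch:
  assumes "log_branch L \<theta>" "z \<in> half_plane \<theta>"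
  shows "norm z = exp (Re (L z))"
  using log_branch_exp[OF assms] by (metis norm_exp_eq_Re)

text \<open>\<open>L\<close> and a rotated principal logarithm both have derivative 1/z on a convex
  set, so they differ by a constant. The bound makes the modulus of x^s comparable to that of x
  raised to Re s.\<close>

lemma Im_log_branch_bounded:
  assumes "log_branch L \<theta>"
  obtains B where "B \<ge> 0" "\<And>z. z \<in> half_plane \<theta> \<Longrightarrow> \<bar>Im (L z)\<bar> \<le> B"
proof -
  have "((\<lambda>z. L z - Ln (z * cis (- \<theta>))) has_field_derivative 0) (at z within half_plane \<theta>)"
    if z: "z \<in> half_plane \<theta>" for z
  proof -
    have "Re (z * cis (- \<theta>)) > 0"
      using z by (simp add: half_plane_iff half_plane_height_def)
    hence "z * cis (- \<theta>) \<notin> \<real>\<^sub>\<le>\<^sub>0"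
      using complex_nonpos_Reals_iff by force
    hence "((\<lambda>z. L z - Ln (z * cis (- \<theta>))) has_field_derivative 1 / z - inverse (z * cis (- \<theta>)) * cis (- \<theta>)) (at z)"
      by (auto intro!: derivative_eq_intros log_branch_has_field_derivative[OF assms z])
    also have "1 / z - inverse (z * cis (- \<theta>)) * cis (- \<theta>) = 0"
      using half_plane_nonzero[OF z] by (simp add: field_simps)
    finally show ?thesis by (rule has_field_derivative_at_within)
  qed
  from has_field_derivative_zero_constant[OF convex_half_plane this]
  obtain c where c: "\<And>z. z \<in> half_plane \<theta> \<Longrightarrow> L z - Ln (z * cis (- \<theta>)) = c" by blast
  have "\<bar>Im (L z)\<bar> \<le> pi + \<bar>Im c\<bar>" if "z \<in> half_plane \<theta>" for z
  proof -
    have "z * cis (- \<theta>) \<noteq> 0" using half_plane_nonzero[OF that] by simp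
    from mpi_less_Im_Ln[OF this] Im_Ln_le_pi[OF this]
    have "\<bar>Im (Ln (z * cis (- \<theta>)))\<bar> \<le> pi" by simp
    moreover have "L z = Ln (z * cis (- \<theta>)) + c" using c[OF that] by (simp add: algebra_simps)
    hence "Im (L z) = Im (Ln (z * cis (- \<theta>))) + Im c" by simp
    ultimately show ?thesis by linarith
  qed
  thus ?thesis using that[of "pi + \<bar>Im c\<bar>"] by simp
qed

section \<open>The expansion of the summand and its error term\<close>

text \<open>
  The \<open>k\<close>-th derivative with respect to \<open>x\<close> of \<open>x\<^bsup>d - \<alpha>\<^esup>\<close>. For \<open>k = d\<close> this is \<open>\<Prod>\<^sub>j (j - \<alpha>) x\<^bsup>-\<alpha>\<^esup>\<close> with \<open>j\<close> from
  \<open>1\<close> to \<open>d\<close>: clearing the denominators of the iterated antiderivatives makes everything entire in \<open>\<alpha>\<close>.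
\<close>

definition power_deriv :: "nat \<Rightarrow> (complex \<Rightarrow> complex) \<Rightarrow> nat \<Rightarrow> complex \<Rightarrow> complex \<Rightarrow> complex" where
  "power_deriv d L k \<alpha> x =
     (\<Prod>i<k. of_nat d - \<alpha> - of_nat i) * exp ((of_nat d - \<alpha> - of_nat k) * L x)"

lemma has_field_derivative_power_deriv:
  assumes "log_branch L \<theta>" "x \<in> half_plane \<theta>"
  shows "(power_deriv d L k \<alpha> has_field_derivative power_deriv d L (Suc k) \<alpha> x) (at x)"
proof -
  define s where "s = of_nat d - \<alpha> - of_nat k"
  have "x = exp (L x)" by (simp add: log_branch_exp[OF assms])
  hence "exp (s * L x) / x = exp (s * L x) / exp (L x)" by simp
  also have "\<dots> = exp ((s - 1) * L x)"
    by (simp add: exp_diff algebra_simps)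
  finally have "exp (s * L x) / x = exp ((s - 1) * L x)" .
  moreover have "of_nat d - \<alpha> - of_nat (Suc k) = s - 1"
    by (simp add: s_def)
  ultimately have "power_deriv d L (Suc k) \<alpha> x = (\<Prod>i<k. of_nat d - \<alpha> - of_nat i) * s * (exp (s * L x) / x)"
    unfolding power_deriv_def prod.lessThan_Suc s_def by argo
  hence "power_deriv d L (Suc k) \<alpha> x = (\<Prod>i<k. of_nat d - \<alpha> - of_nat i) * (exp (s * L x) * (s * (1 / x)))"
    by simp
  moreover have "((\<lambda>x. (\<Prod>i<k. of_nat d - \<alpha> - of_nat i) * exp (s * L x)) has_field_derivative
      (\<Prod>i<k. of_nat d - \<alpha> - of_nat i) * (exp (s * L x) * (s * (1 / x)))) (at x)"
    by (intro DERIV_cmult DERIV_fun_exp log_branch_has_field_derivative[OF assms])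
  moreover have "power_deriv d L k \<alpha> = (\<lambda>x. (\<Prod>i<k. of_nat d - \<alpha> - of_nat i) * exp (s * L x))"
    by (simp add: power_deriv_def s_def fun_eq_iff)
  ultimately show ?thesis by (simp only:)
qed

text \<open>The modulus of x^s is |x|^(Re s) exp(- Im s Im (L x)). The second factor is bounded
  uniformly for |\<alpha>| at most \<open>R\<close>; in the first, the exponent is nonpositive, so
  |x| may be replaced by the smaller \<open>h\<close>.\<close>

lemma norm_power_deriv_le:
  assumes "log_branch L \<theta>"
  obtains C where "C \<ge> 0"
    "\<And>\<alpha> x h. \<lbrakk>norm \<alpha> \<le> R; real d \<le> Re \<alpha> + real k; 0 < h; h \<le> half_plane_height \<theta> x\<rbrakk> \<Longrightarrow>
       norm (power_deriv d L k \<alpha> x) \<le> C * h powr (real d - Re \<alpha> - real k)"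
proof -
  obtain B where B: "B \<ge> 0" "\<And>z. z \<in> half_plane \<theta> \<Longrightarrow> \<bar>Im (L z)\<bar> \<le> B"
    using Im_log_branch_bounded[OF assms] by blast
  define C where "C = (\<Prod>i<k. real d + \<bar>R\<bar> + real i) * exp (\<bar>R\<bar> * B)"
  have "norm (power_deriv d L k \<alpha> x) \<le> C * h powr (real d - Re \<alpha> - real k)"
    if *: "norm \<alpha> \<le> R" "real d \<le> Re \<alpha> + real k" "0 < h" "h \<le> half_plane_height \<theta> x" for \<alpha> x h
  proof -
    have x: "x \<in> half_plane \<theta>" using * by (simp add: half_plane_iff)
    have hx: "h \<le> norm x" using *(4) half_plane_height_le_norm[of \<theta> x] by linarith
    define t where "t = real d - Re \<alpha> - real k"
    have "norm (exp ((of_nat d - \<alpha> - of_nat k) * L x)) = exp (t * Re (L x) + Im \<alpha> * Im (L x))"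
      by (simp add: norm_exp_eq_Re t_def)
    also have "\<dots> = exp (t * Re (L x)) * exp (Im \<alpha> * Im (L x))"
      by (rule exp_add)
    also have "exp (t * Re (L x)) = norm x powr t"
      using norm_eq_exp_Re_log_branch[OF assms x] by (simp add: powr_def)
    also have "norm x powr t \<le> h powr t"
      using * hx by (intro powr_mono2') (auto simp: t_def)
    also have "Im \<alpha> * Im (L x) \<le> \<bar>Im \<alpha>\<bar> * \<bar>Im (L x)\<bar>"
      by (metis abs_ge_self abs_mult)
    also have "\<dots> \<le> \<bar>R\<bar> * B"
      using B(2)[OF x] *(1) abs_Im_le_cmod[of \<alpha>] by (intro mult_mono) auto
    finally have 1: "norm (exp ((of_nat d - \<alpha> - of_nat k) * L x)) \<le> h powr t * exp (\<bar>R\<bar> * B)"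
      by (auto simp: mult_left_mono)
    have 2: "norm (\<Prod>i<k. of_nat d - \<alpha> - of_nat i) \<le> (\<Prod>i<k. real d + \<bar>R\<bar> + real i)"
      unfolding prod_norm[symmetric]
    proof (intro prod_mono conjI)
      fix i
      have "norm (of_nat d - \<alpha> - of_nat i) \<le> norm (of_nat d - \<alpha>) + norm (of_nat i :: complex)"
        by (rule norm_triangle_ineq4)
      also have "norm (of_nat d - \<alpha>) \<le> norm (of_nat d :: complex) + norm \<alpha>"
        by (rule norm_triangle_ineq4)
      finally show "norm (of_nat d - \<alpha> - of_nat i) \<le> real d + \<bar>R\<bar> + real i"
        using *(1) by simp
    qed auto
    have "norm (power_deriv d L k \<alpha> x) \<le> (\<Prod>i<k. real d + \<bar>R\<bar> + real i) * (h powr t * exp (\<bar>R\<bar> * B))"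
      unfolding power_deriv_def norm_mult
      by (intro mult_mono 1 2 prod_nonneg) auto
    thus ?thesis by (simp add: C_def t_def mult_ac)
  qed
  moreover have "C \<ge> 0" unfolding C_def by (intro mult_nonneg_nonneg prod_nonneg) auto
  ultimately show ?thesis using that by blast
qed

section \<open>Inversion of the iterated difference and its Taylor error\<close>

text \<open>The coefficients of \<open>z\<^sup>d / \<Prod>(1 - exp (w\<^sub>i z))\<close>.\<close>

definition em_coeff :: "nat \<Rightarrow> (nat \<Rightarrow> complex) \<Rightarrow> nat \<Rightarrow> complex" where
  "em_coeff d w m = (- 1) ^ d * fps_nth (bernoulli_fps d w) m / (\<Prod>i=1..d. w i)"

text \<open>The first \<open>N\<close> terms of the inverse symbol, applied to \<Prod>(j - \<alpha>)
  x^(-\<alpha>) instead of x^(-\<alpha>): the term z^(m-d) turns the d-th derivative of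
  x^(d-\<alpha>) into the m-th.\<close>

definition em_main where
  "em_main d w L N \<alpha> x = (\<Sum>m<N. em_coeff d w m * power_deriv d L m \<alpha> x)"

definition em_error where
  "em_error d w L N \<alpha> x = power_deriv d L d \<alpha> x -
     (\<Sum>S\<in>Pow {1..d}. (- 1) ^ card S * em_main d w L N \<alpha> (x + (\<Sum>i\<in>S. w i)))"

text \<open>Comparison of the coefficients of z^j in (\<Sum> c_m z^m) \<Prod>(1 - e^(w_i z)) = z^d,
  with c_m the numbers \<open>em_coeff\<close>.\<close>

lemma em_coeff_convolution:
  assumes "\<And>i. i \<in> {1..d} \<Longrightarrow> w i \<noteq> 0"
  shows "(\<Sum>m\<le>j. em_coeff d w m * ((\<Sum>S\<in>Pow {1..d}. (- 1) ^ card S * (\<Sum>i\<in>S. w i) ^ (j - m)) / fact (j - m))) =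
           (if j = d then 1 else 0)"
proof -
  define W where "W = (\<Prod>i=1..d. w i)"
  have W: "W \<noteq> 0" "prod w {Suc 0..d} = W" using assms by (auto simp: W_def)
  have nth: "fps_nth (\<Prod>i=1..d. 1 - fps_exp (w i)) k = 
        (\<Sum>S\<in>Pow {1..d}. (- 1) ^ card S * (\<Sum>i\<in>S. w i) ^ k) / fact k" for k
    using alternating_fps_exp_sum[of "{1..d}" 0 w, symmetric]
    by (simp add: alternating_fps_exp_sum_nth)
  have "(\<Sum>m\<le>j. em_coeff d w m * ((\<Sum>S\<in>Pow {1..d}. (- 1) ^ card S * (\<Sum>i\<in>S. w i) ^ (j - m)) / fact (j - m))) =
        (- 1) ^ d / W * fps_nth (bernoulli_fps d w * (\<Prod>i=1..d. 1 - fps_exp (w i))) j"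
    unfolding fps_mult_nth nth em_coeff_def W_def[symmetric] sum_distrib_left atLeast0AtMost
    by (intro sum.cong) auto
  also have "\<dots> = (if j = d then 1 else 0)"
    using W by (subst bernoulli_fps_mult) 
      (use assms in \<open>auto simp: W_def[symmetric] fps_X_power_nth simp flip: power_mult_distrib\<close>)
  finally show ?thesis .
qed

text \<open>Here \<open>f k\<close> stands for a k-th derivative at x. With Taylor polynomials in
  place of the shifted functions the inversion is exact: grouping by the total order j = m + i
  produces the convolution above, and only j = d survives.\<close>

lemma em_taylor_part:
  fixes f :: "nat \<Rightarrow> complex"
  assumes w: "\<And>i. i \<in> {1..d} \<Longrightarrow> w i \<noteq> 0" and "N \<ge> 1"
  shows "(\<Sum>S\<in>Pow {1..d}. (- 1) ^ card S * (\<Sum>m<N. em_coeff d w m * 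
           (\<Sum>i<N + d - m. f (m + i) * (\<Sum>i\<in>S. w i) ^ i / fact i))) = f d"
proof -
  define e where "e i = (\<Sum>S\<in>Pow {1..d}. (- 1) ^ card S * (\<Sum>i\<in>S. w i) ^ i) / fact i" for i
  define K where "K = N + d"
  have e_0: "e i = 0" if "i < d" for i
    using alternating_power_sum_eq_0[of "{1..d}" i 0 w] that by (simp add: e_def)
  have "(\<Sum>S\<in>Pow {1..d}. (- 1) ^ card S * (\<Sum>m<N. em_coeff d w m * 
           (\<Sum>i<N + d - m. f (m + i) * (\<Sum>i\<in>S. w i) ^ i / fact i))) =
        (\<Sum>S\<in>Pow {1..d}. \<Sum>m<N. \<Sum>i<K - m. em_coeff d w m * f (m + i) * ((- 1) ^ card S * (\<Sum>i\<in>S. w i) ^ i / fact i))"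
    by (simp add: sum_distrib_left K_def mult_ac)
  also have "\<dots> = (\<Sum>m<N. \<Sum>i<K - m. \<Sum>S\<in>Pow {1..d}. em_coeff d w m * f (m + i) * ((- 1) ^ card S * (\<Sum>i\<in>S. w i) ^ i / fact i))"
    by (subst sum.swap, intro sum.cong refl, rule sum.swap)
  also have "\<dots> = (\<Sum>m<N. \<Sum>i<K - m. em_coeff d w m * f (m + i) * e i)"
    by (simp add: e_def sum_divide_distrib sum_distrib_left)
  \<comment> \<open>The added terms have m at least N, hence i < d, where \<open>e i\<close>
    vanishes. The index set is now a full triangle.\<close>
  also have "\<dots> = (\<Sum>m<K. \<Sum>i<K - m. em_coeff d w m * f (m + i) * e i)"
    by (intro sum.mono_neutral_left) (auto simp: K_def e_0 intro!: sum.neutral)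
  also have "\<dots> = (\<Sum>(m,i)\<in>(SIGMA m:{..<K}. {..<K - m}). em_coeff d w m * f (m + i) * e i)"
    by (rule sum.Sigma) auto
  also have "(SIGMA m:{..<K}. {..<K - m}) = {(m, i). m + i < K}"
    by auto
  also have "(\<Sum>(m,i)\<in>{(m, i). m + i < K}. em_coeff d w m * f (m + i) * e i) =
             (\<Sum>j<K. \<Sum>m\<le>j. em_coeff d w m * f (m + (j - m)) * e (j - m))"
    by (rule sum.triangle_reindex)
  also have "\<dots> = (\<Sum>j<K. f j * (\<Sum>m\<le>j. em_coeff d w m * e (j - m)))"
    by (intro sum.cong refl) (simp add: sum_distrib_left mult_ac)
  also have "\<dots> = (\<Sum>j<K. if j = d then f j else 0)"
    using em_coeff_convolution[OF w] by (intro sum.cong refl) (simp add: e_def)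
  also have "\<dots> = f d"
    using assms(2) by (simp add: K_def)
  finally show ?thesis .
qed

text \<open>By \<open>em_taylor_part\<close> the Taylor polynomials reproduce the leading term
  exactly, so only Taylor remainders are left. All of them involve the derivative of order N + d of
  x^(d-\<alpha>), which has size h^(-Re \<alpha> - N).\<close>

lemma em_error_bound:
  assumes L: "log_branch L \<theta>" and w: "\<And>i. i \<in> {1..d} \<Longrightarrow> w i \<in> half_plane \<theta>" and "N \<ge> 1"
  obtains C where "C \<ge> 0"
    "\<And>\<alpha> x. \<lbrakk>norm \<alpha> \<le> R; 0 \<le> Re \<alpha> + real N; x \<in> half_plane \<theta>\<rbrakk> \<Longrightarrow>
       norm (em_error d w L N \<alpha> x) \<le> C * half_plane_height \<theta> x powr (- (Re \<alpha> + real N))"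
proof -
  define K where "K = N + d"
  define W where "W S = (\<Sum>i\<in>S. w i)" for S
  obtain C0 where C0: "C0 \<ge> 0"
    "\<And>\<alpha> x h. \<lbrakk>norm \<alpha> \<le> R; real d \<le> Re \<alpha> + real K; 0 < h; h \<le> half_plane_height \<theta> x\<rbrakk> \<Longrightarrow>
       norm (power_deriv d L K \<alpha> x) \<le> C0 * h powr (real d - Re \<alpha> - real K)"
    using norm_power_deriv_le[OF L] by blast
  define C where "C = (\<Sum>S\<in>Pow {1..d}. \<Sum>m<N. norm (em_coeff d w m) * (C0 * norm (W S) ^ (K - m) / fact (K - m - 1)))"
  have "norm (em_error d w L N \<alpha> x) \<le> C * half_plane_height \<theta> x powr (- (Re \<alpha> + real N))"
    if *: "norm \<alpha> \<le> R" "0 \<le> Re \<alpha> + real N" "x \<in> half_plane \<theta>" for \<alpha> x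
  proof -
    define h where "h = half_plane_height \<theta> x"
    have h: "h > 0" using *(3) by (simp add: h_def half_plane_iff)
    define b where "b = h powr (- (Re \<alpha> + real N))"
    \<comment> \<open>A convex set containing x and all corners x + \<open>W S\<close>, on which the
      height is at least h; the derivative bound is therefore uniform on it.\<close>
    define H where "H = {z. half_plane_height \<theta> z \<ge> h}"
    have H_sub: "z \<in> half_plane \<theta>" if "z \<in> H" for z
      using that h by (simp add: half_plane_iff H_def)
    define f where "f k = power_deriv d L k \<alpha>" for k
    define T where "T m S = (\<Sum>i<N + d - m. f (m + i) x * W S ^ i / fact i)" for m S
    have taylor: "norm (T m S - f m (x + W S)) \<le> C0 * norm (W S) ^ (K - m) / fact (K - m - 1) * b"
      if "m < N" "S \<in> Pow {1..d}" for m S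
    proof -
      \<comment> \<open>The degree of the Taylor polynomial \<open>T m S\<close>. The remainder uses
        the derivative of order m + n + 1 = K, the same for every m.\<close>
      define n where "n = K - m - 1"
      have n: "K - m = Suc n" "m + Suc n = K" using that(1) by (auto simp: n_def K_def)
      have WS: "half_plane_height \<theta> (W S) \<ge> 0"
        unfolding W_def half_plane_height_sum
        using that(2) w by (intro sum_nonneg) (force simp: half_plane_iff)
      have "norm (f (m + 0) (x + W S) - (\<Sum>i\<le>n. f (m + i) x * ((x + W S) - x) ^ i / fact i)) \<le> 
              (C0 * b) * norm ((x + W S) - x) ^ Suc n / fact n"
      proof (rule complex_Taylor[of H n "\<lambda>i. f (m + i)" "C0 * b" x "x + W S"])
        show "convex H" unfolding H_def by (rule convex_half_plane_height_ge)
        show "x \<in> H" "x + W S \<in> H"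
          using WS by (auto simp: H_def h_def half_plane_height_add)
        show "(f (m + i) has_field_derivative f (m + Suc i) z) (at z within H)" if "z \<in> H" for i z
          unfolding f_def add_Suc_right
          by (rule has_field_derivative_at_within[OF has_field_derivative_power_deriv[OF L H_sub[OF that]]])
        show "norm (f (m + Suc n) z) \<le> C0 * b" if "z \<in> H" for z
          unfolding f_def n(2) using C0(2)[of \<alpha> h z] * h that by (simp add: b_def H_def K_def)
      qed
      also have "(\<Sum>i\<le>n. f (m + i) x * ((x + W S) - x) ^ i / fact i) = T m S"
        using n unfolding T_def lessThan_Suc_atMost[symmetric] by (simp add: K_def)
      finally show ?thesis
        by (simp add: n norm_minus_commute mult_ac)
    qed
    have "em_error d w L N \<alpha> x = (\<Sum>S\<in>Pow {1..d}. (- 1) ^ card S * (\<Sum>m<N. em_coeff d w m * T m S)) -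
            (\<Sum>S\<in>Pow {1..d}. (- 1) ^ card S * (\<Sum>m<N. em_coeff d w m * f m (x + W S)))"
      using em_taylor_part[where d = d and w = w and f = "\<lambda>k. f k x", OF half_plane_nonzero[OF w] \<open>N \<ge> 1\<close>]
      unfolding em_error_def em_main_def T_def W_def f_def by simp
    also have "\<dots> = (\<Sum>S\<in>Pow {1..d}. (- 1) ^ card S * (\<Sum>m<N. em_coeff d w m * (T m S - f m (x + W S))))"
      by (simp add: sum_subtractf algebra_simps)
    also have "norm \<dots> \<le> (\<Sum>S\<in>Pow {1..d}. \<Sum>m<N. norm (em_coeff d w m) * (C0 * norm (W S) ^ (K - m) / fact (K - m - 1) * b))"
    proof (rule sum_norm_le)
      fix S assume S: "S \<in> Pow {1..d}"
      show "norm ((- 1) ^ card S * (\<Sum>m<N. em_coeff d w m * (T m S - f m (x + W S))))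
              \<le> (\<Sum>m<N. norm (em_coeff d w m) * (C0 * norm (W S) ^ (K - m) / fact (K - m - 1) * b))"
        unfolding norm_mult norm_power norm_minus_cancel norm_one power_one mult_1
        by (rule sum_norm_le, unfold norm_mult, rule mult_left_mono[OF taylor]) (use S in auto)
    qed
    also have "\<dots> = C * b"
      by (simp add: C_def sum_distrib_right sum_distrib_left mult_ac)
    finally show ?thesis by (simp add: b_def h_def)
  qed
  moreover have "C \<ge> 0"
    unfolding C_def using C0(1) by (intro sum_nonneg) auto
  ultimately show ?thesis using that by blast
qed

section \<open>Telescoping and summability over the lattice\<close>

lemma sum_Pow_insert:
  assumes "finite I" "i \<notin> I"
  shows "(\<Sum>S\<in>Pow (insert i I). f S) = (\<Sum>S\<in>Pow I. f S) + (\<Sum>S\<in>Pow I. f (insert i S))"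
proof -
  have "inj_on (insert i) (Pow I)"
    using assms(2) by (intro inj_onI) (metis PowD insert_ident subsetD)
  thus ?thesis unfolding Pow_insert using assms
    by (subst sum.union_disjoint) (auto simp: sum.reindex)
qed

lemma sum_PiE_insert:
  assumes "i \<notin> I"
  shows "(\<Sum>n\<in>PiE (insert i I) B. f n) = (\<Sum>k\<in>B i. \<Sum>n\<in>PiE I B. f (n(i := k)))"
  unfolding PiE_insert_eq
  by (subst sum.reindex[OF inj_combinator[OF assms]])
     (simp add: sum.cartesian_product case_prod_unfold)

text \<open>Induction on the set of coordinates: in each one the sum of 1 - T_w over the M steps of
  length w telescopes to the single difference 1 - T_(Mw).\<close>

lemma sum_PiE_alternating_telescope:
  fixes g :: "complex \<Rightarrow> complex"
  assumes "finite I"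
  shows "(\<Sum>n\<in>PiE I (\<lambda>_. {..<M}). \<Sum>S\<in>Pow I. (- 1) ^ card S * 
            g (x + (\<Sum>i\<in>I. of_nat (n i) * w i) + (\<Sum>i\<in>S. w i))) =
         (\<Sum>S\<in>Pow I. (- 1) ^ card S * g (x + (\<Sum>i\<in>S. of_nat M * w i)))"
  using assms
proof (induction I arbitrary: g rule: finite_induct)
  case empty
  thus ?case by simp
next
  case (insert i I)
  let ?sg = "\<lambda>S. (- 1 :: complex) ^ card S"
  have fin: "finite S" "i \<notin> S" if "S \<in> Pow I" for S
    using that insert.hyps finite_subset by auto
  have "(\<Sum>n\<in>PiE (insert i I) (\<lambda>_. {..<M}). \<Sum>S\<in>Pow (insert i I). ?sg S * 
            g (x + (\<Sum>i\<in>insert i I. of_nat (n i) * w i) + (\<Sum>i\<in>S. w i))) =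
        (\<Sum>k<M. \<Sum>n\<in>PiE I (\<lambda>_. {..<M}). \<Sum>S\<in>Pow I. ?sg S * 
            (g (x + (\<Sum>i\<in>I. of_nat (n i) * w i) + (\<Sum>i\<in>S. w i) + of_nat k * w i) -
             g (x + (\<Sum>i\<in>I. of_nat (n i) * w i) + (\<Sum>i\<in>S. w i) + of_nat (Suc k) * w i)))"
    unfolding sum_PiE_insert[OF insert.hyps(2)]
  proof (rule sum.cong[OF refl], rule sum.cong[OF refl], goal_cases)
    case (1 k n)
    have "(\<Sum>j\<in>insert i I. of_nat ((n(i := k)) j) * w j) = of_nat k * w i + (\<Sum>j\<in>I. of_nat (n j) * w j)"
      using insert.hyps by (simp, intro sum.cong) auto
    thus ?case
      unfolding sum_Pow_insert[OF insert.hyps] sum.distrib[symmetric]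
      by (intro sum.cong refl) (simp add: fin algebra_simps)
  qed
  \<comment> \<open>The induction hypothesis is used for the function y \<mapsto> g (y + k w_i) - g
    (y + (k + 1) w_i), which is why g is generalized.\<close>
  also have "\<dots> = (\<Sum>k<M. \<Sum>S\<in>Pow I. ?sg S * 
            (g (x + (\<Sum>i\<in>S. of_nat M * w i) + of_nat k * w i) -
             g (x + (\<Sum>i\<in>S. of_nat M * w i) + of_nat (Suc k) * w i)))"
    by (rule sum.cong[OF refl], rule insert.IH)
  also have "\<dots> = (\<Sum>S\<in>Pow I. ?sg S * (\<Sum>k<M.
            (g (x + (\<Sum>i\<in>S. of_nat M * w i) + of_nat k * w i) -
             g (x + (\<Sum>i\<in>S. of_nat M * w i) + of_nat (Suc k) * w i))))"
    by (subst sum.swap) (simp add: sum_distrib_left)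
  also have "\<dots> = (\<Sum>S\<in>Pow I. ?sg S * (g (x + (\<Sum>i\<in>S. of_nat M * w i)) -
             g (x + (\<Sum>i\<in>S. of_nat M * w i) + of_nat M * w i)))"
    by (subst sum_lessThan_telescope') simp
  also have "\<dots> = (\<Sum>S\<in>Pow (insert i I). ?sg S * g (x + (\<Sum>i\<in>S. of_nat M * w i)))"
    unfolding sum_Pow_insert[OF insert.hyps] sum.distrib[symmetric]
    by (intro sum.cong refl) (simp add: fin algebra_simps)
  finally show ?case .
qed

lemma sum_cube_em_error:
  assumes "M \<ge> 1"
  shows "(\<Sum>n\<in>cube d (M - 1). em_error d w L N \<alpha> (a + multi_dot d n w)) =
           (\<Sum>n\<in>cube d (M - 1). power_deriv d L d \<alpha> (a + multi_dot d n w)) -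
           (\<Sum>S\<in>Pow {1..d}. (- 1) ^ card S * em_main d w L N \<alpha> (a + (\<Sum>i\<in>S. of_nat M * w i)))"
proof -
  \<comment> \<open>For M = 0 truncated subtraction would give a one-point cube in place of an empty
    one.\<close>
  have "{0..M - 1} = {..<M}" using assms by auto
  thus ?thesis
    using sum_PiE_alternating_telescope[where I = "{1..d}" and M = M and g = "em_main d w L N \<alpha>" and x = a and w = w]
    by (simp add: em_error_def sum_subtractf cube_def multi_dot_def)
qed

text \<open>Every finite set of multi-indices lies in some cube, so unordered sums may be evaluated
  along cubes.\<close>

lemma filterlim_cube:
  "filterlim (\<lambda>M. cube d (M - 1)) (finite_subsets_at_top (multi_indices d)) sequentially"
  unfolding filterlim_def le_filter_def
proof (intro allI impI, unfold eventually_filtermap)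
  fix P assume "eventually P (finite_subsets_at_top (multi_indices d))"
  then obtain X where X: "finite X" "X \<subseteq> multi_indices d" 
      "\<And>Y. \<lbrakk>finite Y; X \<subseteq> Y; Y \<subseteq> multi_indices d\<rbrakk> \<Longrightarrow> P Y"
    by (auto simp: eventually_finite_subsets_at_top)
  define M0 where "M0 = Suc (\<Sum>n\<in>X. \<Sum>i=1..d. n i)"
  show "eventually (\<lambda>M. P (cube d (M - 1))) sequentially"
    using eventually_ge_at_top[of M0]
  proof eventually_elim
    case (elim M)
    have "n i \<le> M - 1" if "n \<in> X" "i \<in> {1..d}" for n i
    proof -
      have "n i \<le> (\<Sum>i=1..d. n i)" using that(2) by (intro member_le_sum) auto
      also have "\<dots> \<le> (\<Sum>n\<in>X. \<Sum>i=1..d. n i)" 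
        using that(1) X(1) by (intro member_le_sum[of n X "\<lambda>n. \<Sum>i=1..d. n i"]) auto
      finally show ?thesis using elim by (simp add: M0_def)
    qed
    hence "X \<subseteq> cube d (M - 1)"
      using X(2) unfolding cube_def multi_indices_def PiE_def Pi_def by auto
    moreover have "finite (cube d (M - 1))" "cube d (M - 1) \<subseteq> multi_indices d"
      by (auto simp: cube_def multi_indices_def intro!: finite_PiE)
    ultimately show ?case using X(3) by blast
  qed
qed

section \<open>Heights of lattice points and convergence of the series\<close>

lemma half_plane_height_multi_dot:
  "half_plane_height \<theta> (a + multi_dot d n w) = 
     half_plane_height \<theta> a + (\<Sum>i=1..d. real (n i) * half_plane_height \<theta> (w i))"
  by (simp add: multi_dot_def half_plane_height_add half_plane_height_sum half_plane_height_of_nat)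

lemma multi_dot_in_half_plane:
  assumes "a \<in> half_plane \<theta>" and w: "\<And>i. i \<in> {1..d} \<Longrightarrow> w i \<in> half_plane \<theta>"
  shows "a + multi_dot d n w \<in> half_plane \<theta>" 
    and "half_plane_height \<theta> (a + multi_dot d n w) \<ge> half_plane_height \<theta> a"
proof -
  have "(\<Sum>i=1..d. real (n i) * half_plane_height \<theta> (w i)) \<ge> 0"
    by (intro sum_nonneg) (use w in \<open>force simp: half_plane_iff\<close>)
  thus "a + multi_dot d n w \<in> half_plane \<theta>" 
       "half_plane_height \<theta> (a + multi_dot d n w) \<ge> half_plane_height \<theta> a"
    using assms(1) by (auto simp: half_plane_iff half_plane_height_multi_dot)
qed

text \<open>If \<mu> bounds all heights from below, the height is at least \<mu> t with t = 1 +
  \<Sum> n_i. Since t is at least each 1 + n_i, t^(-\<sigma>) is at most \<Prod> (1 +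
  n_i)^(-\<sigma>/d), a product of d convergent series because \<sigma> > d.\<close>

lemma summable_on_height_powr:
  assumes a: "a \<in> half_plane \<theta>" and w: "\<And>i. i \<in> {1..d} \<Longrightarrow> w i \<in> half_plane \<theta>"
    and "d \<ge> 1" and \<sigma>: "\<sigma> > real d"
  shows "(\<lambda>n. half_plane_height \<theta> (a + multi_dot d n w) powr (- \<sigma>)) summable_on multi_indices d"
proof -
  define \<mu> where "\<mu> = Min (insert (half_plane_height \<theta> a) ((\<lambda>i. half_plane_height \<theta> (w i)) ` {1..d}))"
  have \<mu>: "\<mu> > 0" "\<mu> \<le> half_plane_height \<theta> a" "\<And>i. i \<in> {1..d} \<Longrightarrow> \<mu> \<le> half_plane_height \<theta> (w i)"
  proof -
    show "\<mu> > 0" "\<mu> \<le> half_plane_height \<theta> a"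
      using a w by (auto simp: \<mu>_def half_plane_iff)
    show "\<mu> \<le> half_plane_height \<theta> (w i)" if "i \<in> {1..d}" for i
      unfolding \<mu>_def by (rule Min_le) (use that in auto)
  qed
  define s where "s = - \<sigma> / real d"
  have s: "s < - 1" using \<sigma> \<open>d \<ge> 1\<close> by (simp add: s_def field_simps)
  have "summable (\<lambda>n. real (Suc n) powr s)"
    by (subst summable_Suc_iff) (use s in \<open>simp add: summable_real_powr_iff\<close>)
  hence "Infinite_Set_Sum.abs_summable_on (\<lambda>n. real (Suc n) powr s) UNIV"
    by (simp add: abs_summable_on_nat_iff')
  hence "Infinite_Set_Sum.abs_summable_on (\<lambda>n. \<Prod>i\<in>{1..d}. real (Suc (n i)) powr s) (multi_indices d)"
    unfolding multi_indices_def by (intro abs_summable_on_prod_PiE) auto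
  hence "Infinite_Set_Sum.abs_summable_on (\<lambda>n. \<mu> powr (- \<sigma>) * (\<Prod>i\<in>{1..d}. real (Suc (n i)) powr s)) (multi_indices d)"
    by (intro abs_summable_on_cmult_right)
  hence "(\<lambda>n. norm (\<mu> powr (- \<sigma>) * (\<Prod>i\<in>{1..d}. real (Suc (n i)) powr s))) summable_on multi_indices d"
    by (subst abs_summable_equivalent)
  hence "(\<lambda>n. norm (half_plane_height \<theta> (a + multi_dot d n w) powr (- \<sigma>))) summable_on multi_indices d"
  proof (rule Infinite_Sum.abs_summable_on_comparison_test)
    fix n
    define t where "t = 1 + (\<Sum>i=1..d. real (n i))"
    have t: "t \<ge> 1" by (auto simp: t_def intro!: sum_nonneg)
    have "\<mu> * t \<le> half_plane_height \<theta> (a + multi_dot d n w)"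
      unfolding half_plane_height_multi_dot t_def distrib_left sum_distrib_left
      by (intro add_mono sum_mono) (use \<mu> in \<open>auto simp: mult.commute[of \<mu>] intro!: mult_left_mono\<close>)
    hence "half_plane_height \<theta> (a + multi_dot d n w) powr (- \<sigma>) \<le> (\<mu> * t) powr (- \<sigma>)"
      using \<mu>(1) t \<sigma> by (intro powr_mono2') auto
    also have "\<dots> = \<mu> powr (- \<sigma>) * t powr (- \<sigma>)"
      using \<mu>(1) t by (simp add: powr_mult)
    also have "t powr (- \<sigma>) = (\<Prod>i\<in>{1..d}. t powr s)"
      using t \<open>d \<ge> 1\<close> by (simp add: s_def powr_powr flip: powr_realpow)
    also have "\<dots> \<le> (\<Prod>i\<in>{1..d}. real (Suc (n i)) powr s)"
    proof (intro prod_mono conjI powr_mono2')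
      fix i assume "i \<in> {1..d}"
      hence "real (n i) \<le> (\<Sum>i=1..d. real (n i))" by (intro member_le_sum) auto
      thus "real (Suc (n i)) \<le> t" by (simp add: t_def)
    qed (use s in auto)
    finally show "norm (half_plane_height \<theta> (a + multi_dot d n w) powr (- \<sigma>)) \<le> 
        norm (\<mu> powr (- \<sigma>) * (\<Prod>i\<in>{1..d}. real (Suc (n i)) powr s))"
      by (simp add: mult_left_mono prod_nonneg)
  qed
  thus ?thesis by simp
qed

section \<open>The meromorphic continuation\<close>

lemma has_field_derivative_alpha_power_deriv:
  assumes "\<And>i. i < k \<Longrightarrow> of_nat d - \<alpha> - of_nat i \<noteq> 0"
  shows "((\<lambda>\<alpha>. power_deriv d L k \<alpha> x) has_field_derivative
           power_deriv d L k \<alpha> x * ((\<Sum>i<k. - 1 / (of_nat d - \<alpha> - of_nat i)) - L x)) (at \<alpha>)"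
proof -
  have lin: "((\<lambda>\<alpha>. of_nat d - \<alpha> - of_nat i) has_field_derivative - 1) (at \<alpha>)" for i
    using DERIV_diff[OF DERIV_diff[OF DERIV_const DERIV_ident] DERIV_const] by simp
  have "((\<lambda>\<alpha>. \<Prod>i<k. of_nat d - \<alpha> - of_nat i) has_field_derivative
          (\<Prod>i<k. of_nat d - \<alpha> - of_nat i) * (\<Sum>i<k. - 1 / (of_nat d - \<alpha> - of_nat i))) (at \<alpha>)"
    using assms by (intro has_field_derivative_prod' lin) blast
  moreover have "((\<lambda>\<alpha>. exp ((of_nat d - \<alpha> - of_nat k) * L x)) has_field_derivative
      exp ((of_nat d - \<alpha> - of_nat k) * L x) * (- 1 * L x)) (at \<alpha>)"
    by (intro DERIV_fun_exp DERIV_cmult_right lin)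
  ultimately show ?thesis unfolding power_deriv_def
    by (rule DERIV_cong[OF DERIV_mult]) (simp add: algebra_simps)
qed

lemma holomorphic_power_deriv [holomorphic_intros]:
  "(\<lambda>\<alpha>. power_deriv d L k \<alpha> x) holomorphic_on A"
  unfolding power_deriv_def by (intro holomorphic_intros)

lemma holomorphic_em_main [holomorphic_intros]: "(\<lambda>\<alpha>. em_main d w L N \<alpha> x) holomorphic_on A"
  unfolding em_main_def by (intro holomorphic_intros)

lemma holomorphic_em_error [holomorphic_intros]: "(\<lambda>\<alpha>. em_error d w L N \<alpha> x) holomorphic_on A"
  unfolding em_error_def by (intro holomorphic_intros)

section \<open>Corrected cube sums and their analytic limit\<close>

locale barnes_data =
  fixes \<theta> :: real and L :: "complex \<Rightarrow> complex" and d :: nat 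
    and a :: complex and w :: "nat \<Rightarrow> complex"
  assumes log: "log_branch L \<theta>" and d_pos: "1 \<le> d"
    and a: "a \<in> half_plane \<theta>" and w: "\<And>i. i \<in> {1..d} \<Longrightarrow> w i \<in> half_plane \<theta>"
begin

definition em_partial :: "nat \<Rightarrow> nat \<Rightarrow> complex \<Rightarrow> complex" where
  "em_partial N M \<alpha> = em_main d w L N \<alpha> a + 
     (\<Sum>n\<in>cube d (M - 1). em_error d w L N \<alpha> (a + multi_dot d n w))"

text \<open>The continuation of \<Prod>(j - \<alpha>) times the zeta function to Re \<alpha> > d -
  N, as \<open>has_sum_branch_power\<close> and \<open>holomorphic_em_total\<close> show.\<close>

definition em_total :: "nat \<Rightarrow> complex \<Rightarrow> complex" where
  "em_total N \<alpha> = em_main d w L N \<alpha> a + 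
     (\<Sum>\<^sub>\<infinity>n\<in>multi_indices d. em_error d w L N \<alpha> (a + multi_dot d n w))"

definition em_domain :: "nat \<Rightarrow> complex set" where
  "em_domain N = {\<alpha>. Re \<alpha> > real d - real N}"

lemma open_em_domain: "open (em_domain N)"
  unfolding em_domain_def by (intro open_halfspace_Re_gt)

lemma connected_em_domain: "connected (em_domain N)"
  unfolding em_domain_def by (intro convex_connected convex_halfspace_Re_gt)

text \<open>Weierstrass test on a small closed disc: the errors are dominated by a constant times
  height^(-\<sigma>) with \<sigma> > d.\<close>

lemma uniform_limit_em_partial:
  assumes "N \<ge> 1" "\<alpha>0 \<in> em_domain N"
  shows "\<exists>r>0. cball \<alpha>0 r \<subseteq> em_domain N \<and>
           uniform_limit (cball \<alpha>0 r) (em_partial N) (em_total N) sequentially"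
proof -
  \<comment> \<open>Half the distance from \<open>\<alpha>0\<close> to the boundary line, so that Re
    \<alpha> + N \<ge> d + r on the disc.\<close>
  define r where "r = (Re \<alpha>0 + real N - real d) / 2"
  define \<sigma> where "\<sigma> = real d + r"
  define R where "R = norm \<alpha>0 + r"
  \<comment> \<open>The bound 1 lets the exponent \<sigma> - t be replaced by its minimum \<sigma> -
    R - N, which makes the dominating term independent of \<alpha>.\<close>
  define h0 where "h0 = min 1 (half_plane_height \<theta> a)"
  have r: "r > 0" using assms(2) by (simp add: r_def em_domain_def)
  have h0: "h0 > 0" "h0 \<le> 1" "h0 \<le> half_plane_height \<theta> a"
    using a by (auto simp: h0_def half_plane_iff)
  have Re_ge: "Re \<alpha> + real N \<ge> \<sigma>" and norm_le: "norm \<alpha> \<le> R" if "\<alpha> \<in> cball \<alpha>0 r" for \<alpha>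
  proof -
    have "\<bar>Re \<alpha>0 - Re \<alpha>\<bar> \<le> r"
      using that abs_Re_le_cmod[of "\<alpha>0 - \<alpha>"] by (simp add: dist_norm)
    moreover have "2 * r = Re \<alpha>0 + real N - real d" by (simp add: r_def)
    ultimately show "Re \<alpha> + real N \<ge> \<sigma>" unfolding \<sigma>_def by linarith
    have "norm \<alpha> \<le> norm \<alpha>0 + norm (\<alpha> - \<alpha>0)"
      by (metis add.commute diff_add_cancel norm_triangle_ineq)
    thus "norm \<alpha> \<le> R"
      using that by (simp add: R_def dist_norm norm_minus_commute)
  qed
  have sub: "cball \<alpha>0 r \<subseteq> em_domain N"
    using Re_ge r by (force simp: em_domain_def \<sigma>_def)
  obtain C where C: "C \<ge> 0"
    "\<And>\<alpha> x. \<lbrakk>norm \<alpha> \<le> R; 0 \<le> Re \<alpha> + real N; x \<in> half_plane \<theta>\<rbrakk> \<Longrightarrow>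
       norm (em_error d w L N \<alpha> x) \<le> C * half_plane_height \<theta> x powr (- (Re \<alpha> + real N))"
    using em_error_bound[where d = d and w = w and R = R, OF log w assms(1)] by blast
  define h where "h n = half_plane_height \<theta> (a + multi_dot d n w)" for n
  have "uniform_limit (cball \<alpha>0 r)
          (\<lambda>X \<alpha>. \<Sum>n\<in>X. em_error d w L N \<alpha> (a + multi_dot d n w))
          (\<lambda>\<alpha>. \<Sum>\<^sub>\<infinity>n\<in>multi_indices d. em_error d w L N \<alpha> (a + multi_dot d n w))
          (finite_subsets_at_top (multi_indices d))"
  proof (rule Weierstrass_m_test_general)
    show "(\<lambda>n. C * h0 powr (\<sigma> - R - real N) * h n powr (- \<sigma>)) summable_on multi_indices d"
      unfolding h_def using r
      by (intro summable_on_cmult_right summable_on_height_powr a w d_pos) (auto simp: \<sigma>_def)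
    fix n \<alpha> assume \<alpha>: "\<alpha> \<in> cball \<alpha>0 r"
    define t where "t = Re \<alpha> + real N"
    have t: "\<sigma> \<le> t" "t \<le> R + real N" "0 \<le> t"
      using Re_ge[OF \<alpha>] norm_le[OF \<alpha>] complex_Re_le_cmod[of \<alpha>] r by (auto simp: t_def \<sigma>_def)
    note md = multi_dot_in_half_plane[where d = d and w = w and n = n, OF a w]
    have hn: "h n > 0" "h0 \<le> h n"
      using md h0(3) by (auto simp: h_def half_plane_iff)
    have "norm (em_error d w L N \<alpha> (a + multi_dot d n w)) \<le> C * h n powr (- t)"
      unfolding t_def h_def using t(3) by (intro C(2) norm_le \<alpha> md) (auto simp: t_def)
    also have "h n powr (- t) = h n powr (\<sigma> - t) * h n powr (- \<sigma>)"
      by (simp flip: powr_add)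
    also have "h n powr (\<sigma> - t) \<le> h0 powr (\<sigma> - t)"
      using h0 hn t by (intro powr_mono2') auto
    also have "h0 powr (\<sigma> - t) \<le> h0 powr (\<sigma> - R - real N)"
      using h0 t by (intro powr_mono') auto
    finally show "norm (em_error d w L N \<alpha> (a + multi_dot d n w)) \<le> 
                    C * h0 powr (\<sigma> - R - real N) * h n powr (- \<sigma>)"
      using C(1) by (simp add: mult_left_mono mult_right_mono mult.assoc)
  qed
  hence "uniform_limit (cball \<alpha>0 r)
          (\<lambda>M \<alpha>. \<Sum>n\<in>cube d (M - 1). em_error d w L N \<alpha> (a + multi_dot d n w))
          (\<lambda>\<alpha>. \<Sum>\<^sub>\<infinity>n\<in>multi_indices d. em_error d w L N \<alpha> (a + multi_dot d n w)) sequentially"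
    by (rule filterlim_compose[OF _ filterlim_cube])
  hence "uniform_limit (cball \<alpha>0 r) (em_partial N) (em_total N) sequentially"
    unfolding em_partial_def[abs_def] em_total_def[abs_def]
    by (intro uniform_limit_add uniform_limit_const)
  thus ?thesis using r sub by blast
qed

lemma em_partial_deriv:
  "(em_partial N M has_field_derivative deriv (em_partial N M) \<alpha>) (at \<alpha>)"
proof -
  have "em_partial N M holomorphic_on UNIV"
    unfolding em_partial_def[abs_def] by (intro holomorphic_intros)
  thus ?thesis by (rule holomorphic_derivI) auto
qed

text \<open>Locally uniform limits of holomorphic functions may be differentiated termwise. The
  derivatives are what the finite part needs.\<close>

lemma em_total_deriv:
  assumes "N \<ge> 1" "\<alpha> \<in> em_domain N"
  obtains D where "(em_total N has_field_derivative D) (at \<alpha>)"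
    and "(\<lambda>M. deriv (em_partial N M) \<alpha>) \<longlonglongrightarrow> D"
proof -
  from has_complex_derivative_uniform_sequence[OF open_em_domain em_partial_deriv
          uniform_limit_em_partial[OF assms(1)]]
  obtain g' where "\<forall>\<alpha>\<in>em_domain N. (em_total N has_field_derivative g' \<alpha>) (at \<alpha>) \<and>
    (\<lambda>M. deriv (em_partial N M) \<alpha>) \<longlonglongrightarrow> g' \<alpha>" ..
  thus ?thesis using assms(2) that[of "g' \<alpha>"] by simp
qed

lemma em_partial_tendsto:
  assumes "N \<ge> 1" "\<alpha> \<in> em_domain N"
  shows "(\<lambda>M. em_partial N M \<alpha>) \<longlonglongrightarrow> em_total N \<alpha>"
proof -
  obtain r where "r > 0" "uniform_limit (cball \<alpha> r) (em_partial N) (em_total N) sequentially"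
    using uniform_limit_em_partial[OF assms] by blast
  thus ?thesis by (intro tendsto_uniform_limitI) auto
qed

lemma holomorphic_em_total:
  assumes "N \<ge> 1"
  shows "em_total N holomorphic_on em_domain N"
  unfolding holomorphic_on_open[OF open_em_domain]
proof
  fix \<alpha> assume "\<alpha> \<in> em_domain N"
  from em_total_deriv[OF assms this] obtain D where "(em_total N has_field_derivative D) (at \<alpha>)" .
  thus "\<exists>f'. (em_total N has_field_derivative f') (at \<alpha>)" ..
qed

text \<open>After telescoping, the empty corner contributes \<open>em_main\<close> at a, which
  cancels the summand in front.\<close>

lemma em_partial_eq:
  assumes "M \<ge> 1"
  shows "em_partial N M \<alpha> = (\<Sum>n\<in>cube d (M - 1). power_deriv d L d \<alpha> (a + multi_dot d n w)) -
           (\<Sum>S\<in>Pow {1..d} - {{}}. (- 1) ^ card S * em_main d w L N \<alpha> (a + (\<Sum>i\<in>S. of_nat M * w i)))"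
  unfolding em_partial_def sum_cube_em_error[OF assms]
  by (subst sum.remove[of "Pow {1..d}" "{}"]) auto

definition barnes_denom :: "complex \<Rightarrow> complex" where
  "barnes_denom \<alpha> = (\<Prod>i<d. of_nat d - \<alpha> - of_nat i)"

lemma power_deriv_d: "power_deriv d L d \<alpha> x = barnes_denom \<alpha> * branch_power L x (- \<alpha>)"
  by (simp add: power_deriv_def barnes_denom_def branch_power_def)

lemma barnes_denom_nonzero: "Re \<alpha> > real d \<Longrightarrow> barnes_denom \<alpha> \<noteq> 0"
proof -
  assume *: "Re \<alpha> > real d"
  have "Re (of_nat d - \<alpha> - of_nat i) < 0" for i using * by simp
  hence "of_nat d - \<alpha> - of_nat i \<noteq> 0" for i by (metis less_irrefl zero_complex.sel(1))
  thus "barnes_denom \<alpha> \<noteq> 0" by (simp add: barnes_denom_def)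
qed

text \<open>At a nonempty corner the height grows linearly in M, while all exponents d - \<alpha> -
  m have negative real part.\<close>

lemma em_main_tendsto_0:
  assumes "Re \<alpha> > real d" "S \<in> Pow {1..d} - {{}}"
  shows "(\<lambda>M. em_main d w L N \<alpha> (a + (\<Sum>i\<in>S. of_nat M * w i))) \<longlonglongrightarrow> 0"
proof -
  define \<eta> where "\<eta> = half_plane_height \<theta> (\<Sum>i\<in>S. w i)"
  have "finite S" using assms(2) finite_subset by auto
  hence \<eta>: "\<eta> > 0"
    unfolding \<eta>_def half_plane_height_sum using assms(2) w
    by (intro sum_pos) (auto simp flip: half_plane_iff)
  define h where "h M = half_plane_height \<theta> a + real M * \<eta>" for M
  have h: "half_plane_height \<theta> (a + (\<Sum>i\<in>S. of_nat M * w i)) = h M" for M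
    by (simp add: h_def \<eta>_def half_plane_height_add half_plane_height_of_nat flip: sum_distrib_left)
  have h_pos: "h M > 0" for M
    using \<eta> a by (auto simp: h_def half_plane_iff intro!: add_pos_nonneg)
  have h_lim: "filterlim h at_top sequentially"
    unfolding h_def
    by (intro filterlim_tendsto_add_at_top[OF tendsto_const] 
          filterlim_at_top_mult_tendsto_pos[OF tendsto_const \<eta>] filterlim_real_sequentially)
  have "(\<lambda>M. power_deriv d L m \<alpha> (a + (\<Sum>i\<in>S. of_nat M * w i))) \<longlonglongrightarrow> 0" for m
  proof -
    obtain C where C: "C \<ge> 0" 
      "\<And>\<alpha>' x h. \<lbrakk>norm \<alpha>' \<le> norm \<alpha>; real d \<le> Re \<alpha>' + real m; 0 < h; h \<le> half_plane_height \<theta> x\<rbrakk> \<Longrightarrow>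
       norm (power_deriv d L m \<alpha>' x) \<le> C * h powr (real d - Re \<alpha>' - real m)"
      using norm_power_deriv_le[OF log] by blast
    show ?thesis
    proof (rule Lim_null_comparison)
      show "eventually (\<lambda>M. norm (power_deriv d L m \<alpha> (a + (\<Sum>i\<in>S. of_nat M * w i))) \<le> 
              C * h M powr (real d - Re \<alpha> - real m)) sequentially"
        using assms(1) h h_pos by (intro always_eventually allI C(2)) auto
      have "(\<lambda>M. h M powr (real d - Re \<alpha> - real m)) \<longlonglongrightarrow> 0"
        using assms(1) by (intro tendsto_neg_powr h_lim) auto
      thus "(\<lambda>M. C * h M powr (real d - Re \<alpha> - real m)) \<longlonglongrightarrow> 0"
        by (rule tendsto_mult_right_zero)
    qed
  qed
  thus ?thesis unfolding em_main_def
    by (intro tendsto_null_sum tendsto_mult_right_zero)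
qed

text \<open>The series converges absolutely, so its cube sums converge to its sum. They differ from
  \<open>em_partial\<close> only by corner terms tending to 0, hence share the limit
  \<open>em_total\<close>.\<close>

lemma has_sum_branch_power:
  assumes "Re \<alpha> > real d" "N \<ge> 1"
  shows "((\<lambda>n. branch_power L (a + multi_dot d n w) (- \<alpha>)) has_sum (em_total N \<alpha> / barnes_denom \<alpha>))
           (multi_indices d)"
proof -
  let ?f = "\<lambda>n. power_deriv d L d \<alpha> (a + multi_dot d n w)"
  obtain C where C: "C \<ge> 0" 
    "\<And>\<alpha>' x h. \<lbrakk>norm \<alpha>' \<le> norm \<alpha>; real d \<le> Re \<alpha>' + real d; 0 < h; h \<le> half_plane_height \<theta> x\<rbrakk> \<Longrightarrow>
     norm (power_deriv d L d \<alpha>' x) \<le> C * h powr (real d - Re \<alpha>' - real d)"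
    using norm_power_deriv_le[OF log] by blast
  have "(\<lambda>n. norm (?f n)) summable_on multi_indices d"
  proof (rule Infinite_Sum.abs_summable_on_comparison_test')
    show "(\<lambda>n. C * half_plane_height \<theta> (a + multi_dot d n w) powr (- Re \<alpha>)) summable_on multi_indices d"
      by (intro summable_on_cmult_right summable_on_height_powr a w d_pos assms(1))
    show "norm (?f n) \<le> C * half_plane_height \<theta> (a + multi_dot d n w) powr (- Re \<alpha>)" for n
      using C(2)[of \<alpha> "half_plane_height \<theta> (a + multi_dot d n w)" "a + multi_dot d n w"] assms(1)
        multi_dot_in_half_plane(1)[where d = d and w = w and n = n, OF a w] by (simp add: half_plane_iff)
  qed
  hence "?f summable_on multi_indices d"
    by (rule abs_summable_summable)
  then obtain s where s: "(?f has_sum s) (multi_indices d)"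
    by (auto simp: summable_on_def)
  have "(\<lambda>M. \<Sum>n\<in>cube d (M - 1). ?f n) \<longlonglongrightarrow> s"
    using s unfolding has_sum_def by (rule filterlim_compose[OF _ filterlim_cube])
  hence "(\<lambda>M. (\<Sum>n\<in>cube d (M - 1). ?f n) - (\<Sum>S\<in>Pow {1..d} - {{}}. (- 1) ^ card S * em_main d w L N \<alpha> (a + (\<Sum>i\<in>S. of_nat M * w i))))
      \<longlonglongrightarrow> s - 0"
    by (intro tendsto_diff tendsto_null_sum tendsto_mult_right_zero em_main_tendsto_0 assms(1))
  moreover have "eventually (\<lambda>M. (\<Sum>n\<in>cube d (M - 1). ?f n) - (\<Sum>S\<in>Pow {1..d} - {{}}. (- 1) ^ card S * em_main d w L N \<alpha> (a + (\<Sum>i\<in>S. of_nat M * w i))) = em_partial N M \<alpha>) sequentially"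
    using eventually_ge_at_top[of 1] by eventually_elim (simp add: em_partial_eq)
  ultimately have "(\<lambda>M. em_partial N M \<alpha>) \<longlonglongrightarrow> s"
    by (simp add: filterlim_cong)
  moreover have "(\<lambda>M. em_partial N M \<alpha>) \<longlonglongrightarrow> em_total N \<alpha>"
    using assms by (intro em_partial_tendsto) (auto simp: em_domain_def)
  ultimately have "s = em_total N \<alpha>"
    using LIMSEQ_unique by blast
  moreover have "((\<lambda>n. ?f n / barnes_denom \<alpha>) has_sum (s / barnes_denom \<alpha>)) (multi_indices d)"
    using s by (rule has_sum_divide_const)
  ultimately show ?thesis
    using barnes_denom_nonzero[OF assms(1)] by (simp add: power_deriv_d)
qed

text \<open>For Re \<alpha> > d both sides are \<open>barnes_denom\<close> times the same series;
  the identity theorem extends this to the smaller of the two half-planes.\<close>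

lemma em_total_eq:
  assumes "N \<ge> 1" "N' \<ge> 1" "\<alpha> \<in> em_domain N" "\<alpha> \<in> em_domain N'"
  shows "em_total N \<alpha> = em_total N' \<alpha>"
proof -
  have *: "em_total N \<alpha> = em_total N' \<alpha>" if "1 \<le> N" "N \<le> N'" "\<alpha> \<in> em_domain N" for N N'
  proof (rule analytic_continuation_open[where f = "em_total N" and g = "em_total N'" and z = \<alpha> and s = "{\<alpha>. Re \<alpha> > real d}" and s' = "em_domain N"])
    show "open {\<alpha>. Re \<alpha> > real d}" by (rule open_halfspace_Re_gt)
    show "{\<alpha>. Re \<alpha> > real d} \<noteq> {}"
      by (auto intro!: exI[of _ "of_nat (Suc d)"])
    show "{\<alpha>. Re \<alpha> > real d} \<subseteq> em_domain N" by (auto simp: em_domain_def)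
    show "em_total N holomorphic_on em_domain N"
      using that by (intro holomorphic_em_total)
    show "em_total N' holomorphic_on em_domain N"
      by (rule holomorphic_on_subset[OF holomorphic_em_total]) (use that in \<open>auto simp: em_domain_def\<close>)
    fix z assume "z \<in> {\<alpha>. Re \<alpha> > real d}"
    hence z: "Re z > real d" by simp
    have "em_total N z / barnes_denom z = em_total N' z / barnes_denom z"
      using has_sum_branch_power[OF z, of N] has_sum_branch_power[OF z, of N'] that 
      by (intro has_sum_unique) auto
    thus "em_total N z = em_total N' z"
      using barnes_denom_nonzero[OF z] by simp
  qed (use that open_em_domain connected_em_domain in auto)
  show ?thesis
    using *[of N N'] *[of N' N, symmetric] assms nat_le_linear[of N N'] by blast
qed

text \<open>The order is chosen for each \<alpha> so that its half-plane contains \<alpha>. Since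
  \<open>em_total\<close> does not depend on the order, the pieces glue to an entire
  function.\<close>

definition barnes_numer :: "complex \<Rightarrow> complex" where
  "barnes_numer \<alpha> = em_total (nat \<lceil>real d - Re \<alpha>\<rceil> + 1) \<alpha>"

lemma in_em_domain: "\<alpha> \<in> em_domain (nat \<lceil>real d - Re \<alpha>\<rceil> + 1)"
  using of_nat_ceiling[of "real d - Re \<alpha>"] unfolding em_domain_def mem_Collect_eq of_nat_add of_nat_1 by linarith

lemma barnes_numer_eq:
  assumes "N \<ge> 1" "\<alpha> \<in> em_domain N"
  shows "barnes_numer \<alpha> = em_total N \<alpha>"
  unfolding barnes_numer_def
  by (rule em_total_eq[OF _ assms(1) in_em_domain assms(2)]) simp

lemma holomorphic_barnes_numer: "barnes_numer holomorphic_on UNIV"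
proof -
  have "barnes_numer holomorphic_on (\<Union>N\<in>{1..}. em_domain N)"
  proof (rule holomorphic_on_UN_open)
    fix N :: nat assume "N \<in> {1..}"
    hence N: "N \<ge> 1" by simp
    show "barnes_numer holomorphic_on em_domain N"
      by (rule holomorphic_transform[OF holomorphic_em_total[OF N]])
         (simp add: barnes_numer_eq[OF N])
  qed (rule open_em_domain)
  also have "(\<Union>N\<in>{1..}. em_domain N) = UNIV"
    using in_em_domain by fastforce
  finally show ?thesis .
qed

end

text \<open>The difference vanishes on an open set, so it cannot avoid 0 off a sparse set and must
  vanish off one. Then f and g agree near every point, and niceness recovers the value there: the
  limit, or 0 at a pole.\<close>

lemma nicely_meromorphic_eqI:
  assumes "f nicely_meromorphic_on UNIV" "g nicely_meromorphic_on UNIV"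
    and "open U" "z0 \<in> U" "\<And>z. z \<in> U \<Longrightarrow> f z = g z"
  shows "f = g"
proof -
  have mero: "f meromorphic_on UNIV" "g meromorphic_on UNIV"
    using assms(1,2) by (auto simp: nicely_meromorphic_on_def)
  have "(\<lambda>z. f z - g z) meromorphic_on UNIV"
    by (intro meromorphic_intros mero)
  from meromorphic_imp_constant_or_avoid[OF this open_UNIV connected_UNIV, of 0]
  have "eventually (\<lambda>z. f z - g z = 0) (cosparse UNIV)"
  proof
    assume "eventually (\<lambda>z. f z - g z \<noteq> 0) (cosparse UNIV)"
    hence "eventually (\<lambda>z. f z - g z \<noteq> 0) (at z0)"
      by (simp add: eventually_cosparse_open_eq)
    moreover have "eventually (\<lambda>z. z \<in> U) (at z0)"
      using assms(3,4) by (intro eventually_at_in_open')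
    ultimately have "eventually (\<lambda>z. False) (at z0)"
      by eventually_elim (use assms(5) in auto)
    thus ?thesis by simp
  qed
  hence ev: "eventually (\<lambda>z. f z = g z) (at z)" for z
    by (simp add: eventually_cosparse_open_eq)
  show "f = g"
  proof
    fix z
    have pole: "is_pole f z \<longleftrightarrow> is_pole g z"
      by (rule is_pole_cong[OF ev refl])
    have lim: "(f \<longlongrightarrow> c) (at z) \<longleftrightarrow> (g \<longlongrightarrow> c) (at z)" for c
      by (rule tendsto_cong[OF ev])
    have no_lim: "\<not>(h \<longlongrightarrow> c) (at z)" if "is_pole h z" for h c
      using that not_tendsto_and_filterlim_at_infinity[of "at z" h c] by (auto simp: is_pole_def)
    show "f z = g z"
    proof (cases "is_pole f z")
      case True
      thus ?thesis using assms(1,2) pole no_lim unfolding nicely_meromorphic_on_def by (metis UNIV_I)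
    next
      case False
      hence "(f \<longlongrightarrow> f z) (at z)" "(g \<longlongrightarrow> g z) (at z)"
        using assms(1,2) pole unfolding nicely_meromorphic_on_def by (metis UNIV_I)+
      thus ?thesis using lim LIM_unique by metis
    qed
  qed
qed

text \<open>Division by \<alpha> - q moves the linear Taylor coefficient of g to the constant
  place.\<close>

lemma finite_part_simple_pole:
  assumes "g analytic_on {q}" "eventually (\<lambda>\<alpha>. f \<alpha> = g \<alpha> / (\<alpha> - q)) (at q)"
  shows "finite_part f q = deriv g q"
proof -
  have "(\<lambda>x. g (q + x)) has_laurent_expansion fps_to_fls (fps_expansion g q)"
    by (intro has_laurent_expansion_fps analytic_at_imp_has_fps_expansion assms(1))
  hence "(\<lambda>x. g (q + x) / x) has_laurent_expansion fps_to_fls (fps_expansion g q) / fls_X"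
    by (intro laurent_expansion_intros)
  moreover have "eventually (\<lambda>x. f (q + x) = g (q + x) / x) (at 0)"
    using assms(2) by (subst (asm) at_to_0) (simp add: eventually_filtermap add.commute)
  ultimately have "(\<lambda>x. f (q + x)) has_laurent_expansion fps_to_fls (fps_expansion g q) / fls_X"
    by (subst has_laurent_expansion_cong) auto
  hence "finite_part f q = fls_nth (fps_to_fls (fps_expansion g q) / fls_X) 0"
    unfolding finite_part_def by (subst laurent_expansion_eqI) auto
  also have "\<dots> = deriv g q"
    by (simp add: fls_divide_X fps_expansion_def)
  finally show ?thesis .
qed

section \<open>Products and harmonic sums over the indices other than q\<close>

lemma prod_lessThan_rev:
  fixes \<alpha> :: complex
  assumes "m \<le> d"
  shows "(\<Prod>i<m. of_nat d - \<alpha> - of_nat i) = (\<Prod>j\<in>{d - m<..d}. of_nat j - \<alpha>)"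
  by (rule prod.reindex_bij_witness[of _ "\<lambda>j. d - j" "\<lambda>i. d - i"])
     (use assms in \<open>auto simp: of_nat_diff\<close>)

lemma sum_lessThan_rev:
  fixes \<alpha> :: complex
  assumes "m \<le> d"
  shows "(\<Sum>i<m. - 1 / (of_nat d - \<alpha> - of_nat i)) = (\<Sum>j\<in>{d - m<..d}. - 1 / (of_nat j - \<alpha>))"
  by (rule sum.reindex_bij_witness[of _ "\<lambda>j. d - j" "\<lambda>i. d - i"])
     (use assms in \<open>auto simp: of_nat_diff\<close>)

lemma punctured_prod:
  assumes "q \<ge> 1"
  shows "(\<Prod>j\<in>{1..q + p} - {q}. of_nat j - of_nat q :: complex) = (- 1) ^ (q - 1) * fact (q - 1) * fact p"
proof -
  have split: "{1..q + p} - {q} = {1..<q} \<union> {q<..q + p}" using assms by auto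
  have "(\<Prod>j\<in>{1..q + p} - {q}. of_nat j - of_nat q :: complex) = 
         (\<Prod>j\<in>{1..<q}. of_nat j - of_nat q) * (\<Prod>j\<in>{q<..q + p}. of_nat j - of_nat q)"
    unfolding split by (rule prod.union_disjoint) auto
  also have "(\<Prod>j\<in>{1..<q}. of_nat j - of_nat q :: complex) = (\<Prod>j=1..q - 1. - of_nat j)"
    by (rule prod.reindex_bij_witness[of _ "\<lambda>j. q - j" "\<lambda>j. q - j"]) (auto simp: of_nat_diff)
  also have "\<dots> = (- 1) ^ (q - 1) * fact (q - 1)"
    by (simp add: prod_uminus fact_prod)
  also have "(\<Prod>j\<in>{q<..q + p}. of_nat j - of_nat q :: complex) = (\<Prod>j=1..p. of_nat j)"
    by (rule prod.reindex_bij_witness[of _ "\<lambda>j. q + j" "\<lambda>j. j - q"]) auto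
  also have "\<dots> = fact p" by (simp add: fact_prod)
  finally show ?thesis .
qed

text \<open>The source of the harmonic numbers: the indices below q give -H_(q-1), those above give
  H_p.\<close>

lemma punctured_sum:
  assumes "q \<ge> 1"
  shows "(\<Sum>j\<in>{1..q + p} - {q}. 1 / (of_nat j - of_nat q) :: complex) = harm p - harm (q - 1)"
proof -
  have split: "{1..q + p} - {q} = {1..<q} \<union> {q<..q + p}" using assms by auto
  have "(\<Sum>j\<in>{1..q + p} - {q}. 1 / (of_nat j - of_nat q) :: complex) = 
         (\<Sum>j\<in>{1..<q}. 1 / (of_nat j - of_nat q)) + (\<Sum>j\<in>{q<..q + p}. 1 / (of_nat j - of_nat q))"
    unfolding split by (rule sum.union_disjoint) auto
  also have "(\<Sum>j\<in>{1..<q}. 1 / (of_nat j - of_nat q) :: complex) = (\<Sum>j=1..q - 1. - inverse (of_nat j))"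
    by (rule sum.reindex_bij_witness[of _ "\<lambda>j. q - j" "\<lambda>j. q - j"]) 
       (auto simp: of_nat_diff inverse_eq_divide minus_divide_right simp del: minus_divide_left)
  also have "\<dots> = - harm (q - 1)"
    by (simp add: sum_negf harm_def)
  also have "(\<Sum>j\<in>{q<..q + p}. 1 / (of_nat j - of_nat q) :: complex) = (\<Sum>j=1..p. inverse (of_nat j))"
    by (rule sum.reindex_bij_witness[of _ "\<lambda>j. q + j" "\<lambda>j. j - q"]) (auto simp: inverse_eq_divide)
  also have "\<dots> = harm p" by (simp add: harm_def)
  finally show ?thesis by simp
qed

section \<open>The zeta function as a quotient of entire functions\<close>

context barnes_data
begin

lemma barnes_denom_conv: "barnes_denom \<alpha> = (\<Prod>j\<in>{1..d}. of_nat j - \<alpha>)"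
proof -
  have "{1..d} = {d - d<..d}" by auto
  thus ?thesis using prod_lessThan_rev[of d d \<alpha>] by (simp add: barnes_denom_def)
qed

lemma barnes_quotient_meromorphic: "(\<lambda>\<alpha>. barnes_numer \<alpha> / barnes_denom \<alpha>) meromorphic_on UNIV"
proof -
  have "barnes_denom holomorphic_on UNIV"
    unfolding barnes_denom_def[abs_def] by (intro holomorphic_intros)
  thus ?thesis
    using holomorphic_barnes_numer
    by (intro meromorphic_intros analytic_on_imp_meromorphic_on) (auto simp: analytic_on_open)
qed

text \<open>The quotient is analytic for Re \<alpha> > d and equals the series there.
  \<open>remove_sings\<close> gives it the normalized values, and
  \<open>nicely_meromorphic_eqI\<close> makes it the only candidate.\<close>

lemma barnes_zeta_eq: "barnes_zeta d w L a = remove_sings (\<lambda>\<alpha>. barnes_numer \<alpha> / barnes_denom \<alpha>)"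
  (is "_ = ?f")
proof -
  define P where "P = (\<lambda>f. f nicely_meromorphic_on UNIV \<and>
        (\<forall>\<alpha>. Re \<alpha> > of_nat d \<longrightarrow>
           ((\<lambda>n. branch_power L (a + multi_dot d n w) (- \<alpha>)) has_sum f \<alpha>) (multi_indices d)))"
  have f: "P ?f"
    unfolding P_def
  proof (intro conjI allI impI)
    show "?f nicely_meromorphic_on UNIV"
      by (intro remove_sings_nicely_meromorphic barnes_quotient_meromorphic)
    fix \<alpha> :: complex assume "Re \<alpha> > of_nat d"
    hence \<alpha>: "Re \<alpha> > real d" by simp
    have "(\<lambda>\<alpha>. barnes_numer \<alpha> / barnes_denom \<alpha>) analytic_on {\<alpha>}"
    proof (intro analytic_intros)
      show "barnes_numer analytic_on {\<alpha>}"
        using holomorphic_barnes_numer by (meson analytic_on_open analytic_on_subset open_UNIV subset_UNIV)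
      show "barnes_denom analytic_on {\<alpha>}"
        unfolding barnes_denom_def[abs_def] by (intro analytic_intros)
    qed (use barnes_denom_nonzero[OF \<alpha>] in auto)
    hence "?f \<alpha> = em_total 1 \<alpha> / barnes_denom \<alpha>"
      using \<alpha> by (simp add: barnes_numer_eq em_domain_def)
    thus "((\<lambda>n. branch_power L (a + multi_dot d n w) (- \<alpha>)) has_sum ?f \<alpha>) (multi_indices d)"
      using has_sum_branch_power[OF \<alpha>, of 1] by simp
  qed
  have "(THE f. P f) = ?f"
  proof (rule the_equality[where P = P, OF f])
    fix g assume g: "P g"
    show "g = ?f"
    proof (rule nicely_meromorphic_eqI)
      show "open {\<alpha>. Re \<alpha> > real d}" by (rule open_halfspace_Re_gt)
      show "of_nat (Suc d) \<in> {\<alpha>. Re \<alpha> > real d}" by simp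
      show "g \<alpha> = ?f \<alpha>" if "\<alpha> \<in> {\<alpha>. Re \<alpha> > real d}" for \<alpha>
      proof (rule has_sum_unique)
        show "((\<lambda>n. branch_power L (a + multi_dot d n w) (- \<alpha>)) has_sum g \<alpha>) (multi_indices d)"
          using g that unfolding P_def by auto
        show "((\<lambda>n. branch_power L (a + multi_dot d n w) (- \<alpha>)) has_sum ?f \<alpha>) (multi_indices d)"
          using f that unfolding P_def by auto
      qed
    qed (use f g in \<open>auto simp: P_def\<close>)
  qed
  thus ?thesis by (simp add: barnes_zeta_def P_def)
qed

end

section \<open>The finite part at a pole\<close>

locale barnes_pole = barnes_data +
  fixes q :: nat
  assumes q: "q \<in> {1..d}"
begin

definition cofactor :: "complex \<Rightarrow> complex" where
  "cofactor \<alpha> = (\<Prod>j\<in>{1..d} - {q}. of_nat j - \<alpha>)"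

lemma barnes_denom_eq_cofactor: "barnes_denom \<alpha> = (of_nat q - \<alpha>) * cofactor \<alpha>"
  unfolding barnes_denom_conv cofactor_def using q by (subst prod.remove[of _ q]) auto

lemma cofactor_nonzero: "cofactor (of_nat q) \<noteq> 0"
  by (auto simp: cofactor_def)

lemma cofactor_deriv:
  "(cofactor has_field_derivative
     cofactor (of_nat q) * (\<Sum>j\<in>{1..d} - {q}. - 1 / (of_nat j - of_nat q))) (at (of_nat q))"
proof -
  have lin: "((\<lambda>\<alpha>. of_nat j - \<alpha>) has_field_derivative - 1) (at \<alpha>)" for j and \<alpha> :: complex
    using DERIV_diff[OF DERIV_const DERIV_ident] by simp
  show ?thesis unfolding cofactor_def[abs_def]
    by (intro has_field_derivative_prod' lin) auto
qed

text \<open>The vanishing factor of \<open>barnes_denom\<close> is q - \<alpha> rather than \<alpha>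
  - q; hence the minus sign.\<close>

lemma finite_part_barnes_zeta:
  "finite_part (barnes_zeta d w L a) (of_nat q) = deriv (\<lambda>\<alpha>. - (barnes_numer \<alpha> / cofactor \<alpha>)) (of_nat q)"
proof (rule finite_part_simple_pole)
  show "(\<lambda>\<alpha>. - (barnes_numer \<alpha> / cofactor \<alpha>)) analytic_on {of_nat q}"
  proof (intro analytic_intros)
    show "barnes_numer analytic_on {of_nat q}"
      using holomorphic_barnes_numer by (meson analytic_on_open analytic_on_subset open_UNIV subset_UNIV)
    show "cofactor analytic_on {of_nat q}"
      unfolding cofactor_def[abs_def] by (intro analytic_intros)
  qed (use cofactor_nonzero in auto)
  have "isolated_singularity_at (\<lambda>\<alpha>. barnes_numer \<alpha> / barnes_denom \<alpha>) (of_nat q)"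
    using barnes_quotient_meromorphic meromorphic_on_isolated_singularity meromorphic_on_subset by blast
  hence "eventually (\<lambda>\<alpha>. remove_sings (\<lambda>\<alpha>. barnes_numer \<alpha> / barnes_denom \<alpha>) \<alpha> = barnes_numer \<alpha> / barnes_denom \<alpha>) (at (of_nat q))"
    by (rule eventually_remove_sings_eq_at)
  thus "eventually (\<lambda>\<alpha>. barnes_zeta d w L a \<alpha> = - (barnes_numer \<alpha> / cofactor \<alpha>) / (\<alpha> - of_nat q)) (at (of_nat q))"
    unfolding barnes_zeta_eq
  proof eventually_elim
    case (elim \<alpha>)
    have "barnes_denom \<alpha> = - (cofactor \<alpha> * (\<alpha> - of_nat q))"
      by (simp add: barnes_denom_eq_cofactor algebra_simps)
    thus ?case using elim by simp
  qed
qed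

text \<open>For p = d - q - m this is the derivative at \<alpha> = q of the m-th term of
  \<open>em_main\<close>, without its coefficient, divided by \<open>cofactor\<close>.\<close>

definition kernel :: "nat \<Rightarrow> complex \<Rightarrow> complex" where
  "kernel p x = (- 1) ^ (q - 1) / (fact (q - 1) * fact p) * x ^ p * (harm p - harm (q - 1) - L x)"

text \<open>The factors j - \<alpha> of the numerator have j > d - m \<ge> q, so they all occur in
  \<open>cofactor\<close> and cancel. What remains is x^(d-\<alpha>-m) over the product of j -
  \<alpha> for j in \<open>J\<close>, whose logarithmic derivative gives the harmonic numbers and -L
  x.\<close>

lemma power_deriv_cofactor_deriv:
  assumes m: "m \<le> d - q" and x: "x \<in> half_plane \<theta>"
  shows "((\<lambda>\<alpha>. power_deriv d L m \<alpha> x / cofactor \<alpha>) has_field_derivative kernel (d - q - m) x) (at (of_nat q))"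
proof -
  define p where "p = d - q - m"
  have dm: "d = q + p + m" "m \<le> d" using m q by (auto simp: p_def)
  define J where "J = {1..q + p} - {q}"
  define J' where "J' = {d - m<..d}"
  have J: "{1..d} - {q} = J \<union> J'" "J \<inter> J' = {}" "finite J" "finite J'"
    using dm(1) q by (auto simp: J_def J'_def)
  define A where "A = (\<Prod>j\<in>J. of_nat j - of_nat q :: complex)"
  define B where "B = (\<Prod>j\<in>J'. of_nat j - of_nat q :: complex)"
  have cof: "cofactor (of_nat q) = A * B"
    unfolding cofactor_def J(1) A_def B_def by (rule prod.union_disjoint) (use J in auto)
  have AB: "A \<noteq> 0" "B \<noteq> 0" using cof cofactor_nonzero by auto
  have "exp ((of_nat d - of_nat q - of_nat m) * L x) = exp (of_nat p * L x)"
    using dm(1) by simp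
  also have "\<dots> = x ^ p"
    by (simp add: exp_of_nat_mult log_branch_exp[OF log x])
  finally have pd: "power_deriv d L m (of_nat q) x = B * x ^ p"
    unfolding power_deriv_def prod_lessThan_rev[OF dm(2)] B_def J'_def by simp
  define s where "s = (\<Sum>j\<in>J. - 1 / (of_nat j - of_nat q :: complex))"
  define s' where "s' = (\<Sum>j\<in>J'. - 1 / (of_nat j - of_nat q :: complex))"
  have "((\<lambda>\<alpha>. power_deriv d L m \<alpha> x) has_field_derivative B * x ^ p * (s' - L x)) (at (of_nat q))"
  proof -
    have nz: "of_nat d - of_nat q - of_nat i \<noteq> (0 :: complex)" if "i < m" for i
    proof -
      have "of_nat d - of_nat q - of_nat i = (of_nat (d - q - i) :: complex)"
        using that dm by (simp add: of_nat_diff)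
      also have "\<dots> \<noteq> 0" using that dm by (subst of_nat_eq_0_iff) auto
      finally show ?thesis .
    qed
    show ?thesis
      using has_field_derivative_alpha_power_deriv[of m d "of_nat q" L x, OF nz]
      unfolding pd sum_lessThan_rev[OF dm(2)] s'_def J'_def .
  qed
  moreover have "(\<Sum>j\<in>{1..d} - {q}. - 1 / (of_nat j - of_nat q :: complex)) = s + s'"
    unfolding s_def s'_def J(1) by (rule sum.union_disjoint) (use J in auto)
  hence "(cofactor has_field_derivative A * B * (s + s')) (at (of_nat q))"
    using cofactor_deriv by (simp add: cof)
  ultimately have "((\<lambda>\<alpha>. power_deriv d L m \<alpha> x / cofactor \<alpha>) has_field_derivative
     (B * x ^ p * (s' - L x) * cofactor (of_nat q) - power_deriv d L m (of_nat q) x * (A * B * (s + s'))) / 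
     (cofactor (of_nat q) * cofactor (of_nat q))) (at (of_nat q))"
    by (rule DERIV_divide) (rule cofactor_nonzero)
  also have "(B * x ^ p * (s' - L x) * cofactor (of_nat q) - power_deriv d L m (of_nat q) x * (A * B * (s + s'))) / 
     (cofactor (of_nat q) * cofactor (of_nat q)) = x ^ p / A * (- s - L x)"
    unfolding pd cof using AB by (simp add: field_simps)
  also have "s = - (harm p - harm (q - 1))"
    unfolding s_def J_def using punctured_sum[of q p] q by (simp add: sum_negf)
  also have "A = (- 1) ^ (q - 1) * fact (q - 1) * fact p"
    unfolding A_def J_def using punctured_prod[of q p] q by simp
  also have "x ^ p / ((- 1) ^ (q - 1) * fact (q - 1) * fact p) * (- (- (harm p - harm (q - 1))) - L x) = kernel p x"
    by (cases "even (q - 1)") (simp_all add: kernel_def mult_ac)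
  finally show ?thesis by (simp add: p_def)
qed

text \<open>Near q the quotient is (q - \<alpha>) x^(-\<alpha>). It vanishes at q, so its derivative
  there contains no logarithm.\<close>

lemma power_deriv_d_cofactor_deriv:
  "((\<lambda>\<alpha>. power_deriv d L d \<alpha> x / cofactor \<alpha>) has_field_derivative - branch_power L x (- of_nat q)) (at (of_nat q))"
proof -
  have lin: "((\<lambda>\<alpha>. of_nat q - \<alpha>) has_field_derivative - 1) (at \<alpha>)" for \<alpha> :: complex
    using DERIV_diff[OF DERIV_const DERIV_ident] by simp
  have exp: "((\<lambda>\<alpha>. exp (- \<alpha> * L x)) has_field_derivative exp (- of_nat q * L x) * (- 1 * L x)) (at (of_nat q))"
    by (intro DERIV_fun_exp DERIV_cmult_right DERIV_minus DERIV_ident)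
  have eq: "power_deriv d L d \<alpha> x = (of_nat q - \<alpha>) * (cofactor \<alpha> * exp (- \<alpha> * L x))" for \<alpha>
    by (simp add: power_deriv_d barnes_denom_eq_cofactor branch_power_def)
  have "((\<lambda>\<alpha>. power_deriv d L d \<alpha> x / cofactor \<alpha>) has_field_derivative
    - (cofactor (of_nat q) * exp (- of_nat q * L x)) / cofactor (of_nat q)) (at (of_nat q))"
    unfolding eq
    by (rule DERIV_cong, rule DERIV_divide, rule DERIV_mult, rule lin, rule DERIV_mult, rule cofactor_deriv, 
        rule exp, rule cofactor_deriv, rule cofactor_nonzero)
       (use cofactor_nonzero in simp)
  thus ?thesis using cofactor_nonzero by (simp add: branch_power_def)
qed

end

section \<open>Passage to the limit and rearrangement of the corner terms\<close>

context barnes_pole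
begin

text \<open>The least order N with q > d - N; its terms m < N are exactly those with m \<le> d -
  q.\<close>

definition em_order :: nat where "em_order = d - q + 1"

definition pole_approx :: "nat \<Rightarrow> complex" where
  "pole_approx M = (\<Sum>n\<in>cube d (M - 1). branch_power L (a + multi_dot d n w) (- of_nat q)) +
     (\<Sum>S\<in>Pow {1..d} - {{}}. (- 1) ^ card S *
        (\<Sum>m<em_order. em_coeff d w m * kernel (d - q - m) (a + (\<Sum>i\<in>S. of_nat M * w i))))"

lemma em_partial_cofactor_deriv:
  assumes "M \<ge> 1"
  shows "((\<lambda>\<alpha>. - (em_partial em_order M \<alpha> / cofactor \<alpha>)) has_field_derivative pole_approx M) (at (of_nat q))"
proof -
  have x: "a + (\<Sum>i\<in>S. of_nat M * w i) \<in> half_plane \<theta>" if "S \<in> Pow {1..d} - {{}}" for S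
  proof (rule half_plane_translate[OF a])
    show "0 \<le> half_plane_height \<theta> (\<Sum>i\<in>S. of_nat M * w i)"
      unfolding half_plane_height_sum half_plane_height_of_nat
    proof (intro sum_nonneg mult_nonneg_nonneg)
      fix i assume "i \<in> S"
      hence "w i \<in> half_plane \<theta>" using that by (intro w) auto
      thus "0 \<le> half_plane_height \<theta> (w i)" by (simp add: half_plane_iff)
    qed auto
  qed
  have eq: "- (em_partial em_order M \<alpha> / cofactor \<alpha>) = 
    - (\<Sum>n\<in>cube d (M - 1). power_deriv d L d \<alpha> (a + multi_dot d n w) / cofactor \<alpha>) +
    (\<Sum>S\<in>Pow {1..d} - {{}}. (- 1) ^ card S * (\<Sum>m<em_order. em_coeff d w m * 
      (power_deriv d L m \<alpha> (a + (\<Sum>i\<in>S. of_nat M * w i)) / cofactor \<alpha>)))" for \<alpha>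
  proof -
    have "em_main d w L em_order \<alpha> x / cofactor \<alpha> = 
            (\<Sum>m<em_order. em_coeff d w m * (power_deriv d L m \<alpha> x / cofactor \<alpha>))" for x
      by (simp add: em_main_def sum_divide_distrib)
    note this [symmetric]
    thus ?thesis
      by (simp only:) (simp add: em_partial_eq[OF assms] diff_divide_distrib sum_divide_distrib)
  qed
  have "((\<lambda>\<alpha>. - (em_partial em_order M \<alpha> / cofactor \<alpha>)) has_field_derivative
          - (\<Sum>n\<in>cube d (M - 1). - branch_power L (a + multi_dot d n w) (- of_nat q)) +
          (\<Sum>S\<in>Pow {1..d} - {{}}. (- 1) ^ card S *
             (\<Sum>m<em_order. em_coeff d w m * kernel (d - q - m) (a + (\<Sum>i\<in>S. of_nat M * w i)))))
        (at (of_nat q))"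
    unfolding eq
    by (intro DERIV_add DERIV_minus DERIV_sum DERIV_cmult power_deriv_d_cofactor_deriv
          power_deriv_cofactor_deriv x) (auto simp: em_order_def)
  thus ?thesis by (simp add: pole_approx_def sum_negf)
qed

text \<open>By the quotient rule, the finite part and \<open>pole_approx M\<close> are the same
  expression in the value and derivative at q of \<open>em_total\<close> and of
  \<open>em_partial\<close>, respectively; both of these converge.\<close>

lemma pole_approx_tendsto: "pole_approx \<longlonglongrightarrow> finite_part (barnes_zeta d w L a) (of_nat q)"
proof -
  let ?q = "of_nat q :: complex" and ?N = em_order
  have dom: "?q \<in> em_domain ?N" and N: "?N \<ge> 1"
    using q by (auto simp: em_domain_def em_order_def)
  obtain D where D: "(em_total ?N has_field_derivative D) (at ?q)"
    and lim: "(\<lambda>M. deriv (em_partial ?N M) ?q) \<longlonglongrightarrow> D"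
    by (rule em_total_deriv[OF N dom])
  define c where "c = cofactor ?q"
  define c' where "c' = cofactor ?q * (\<Sum>j\<in>{1..d} - {q}. - 1 / (of_nat j - of_nat q))"
  have c: "c \<noteq> 0" "(cofactor has_field_derivative c') (at ?q)"
    using cofactor_nonzero cofactor_deriv by (auto simp: c_def c'_def)
  have quot: "((\<lambda>\<alpha>. - (f \<alpha> / cofactor \<alpha>)) has_field_derivative - ((f' * c - f ?q * c') / (c * c))) (at ?q)"
    if "(f has_field_derivative f') (at ?q)" for f f'
    unfolding c_def by (intro DERIV_minus DERIV_divide that c(2) cofactor_nonzero)
  have "(barnes_numer has_field_derivative D) (at ?q)"
    by (rule has_field_derivative_transform_within_open[OF D open_em_domain dom])
       (simp add: barnes_numer_eq[OF N])
  from quot[OF this] have fp: "finite_part (barnes_zeta d w L a) ?q = - ((D * c - em_total ?N ?q * c') / (c * c))"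
    by (simp add: finite_part_barnes_zeta DERIV_imp_deriv barnes_numer_eq[OF N dom])
  have "(\<lambda>M. - ((deriv (em_partial ?N M) ?q * c - em_partial ?N M ?q * c') / (c * c))) \<longlonglongrightarrow>
          - ((D * c - em_total ?N ?q * c') / (c * c))"
    by (intro tendsto_intros lim em_partial_tendsto N dom) (use c in auto)
  moreover have "eventually (\<lambda>M. - ((deriv (em_partial ?N M) ?q * c - em_partial ?N M ?q * c') / (c * c)) = pole_approx M) sequentially"
    using eventually_ge_at_top[of 1]
    by eventually_elim (rule DERIV_unique[OF quot[OF em_partial_deriv] em_partial_cofactor_deriv])
  ultimately show ?thesis
    unfolding fp by (rule Lim_transform_eventually)
qed

text \<open>The logarithmic parts of \<open>kernel\<close> give the alternating subset sums. The
  harmonic parts are multiples of x^p with p < d, whose sum over the nonempty corners is -a^p for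
  every M; they form the term outside the limit.\<close>

lemma pole_approx_eq:
  "pole_approx M =
     (- 1) ^ q / fact (q - 1) *
        (\<Sum>m=0..d - q. bernoullian_deriv0 d w m / (fact m * fact (d - q - m)) *
           alt_subset_sum d (\<lambda>x. (a + x) ^ (d - q - m) * L (a + x)) (\<lambda>i. of_nat M * w i))
      + (\<Sum>n\<in>cube d (M - 1). branch_power L (a + multi_dot d n w) (- of_nat q))
      + (- 1) ^ (d - q + 1) / fact (q - 1) *
        (\<Sum>m=0..d - q. bernoullian_deriv0 d w m * a ^ (d - q - m) / (fact m * fact (d - q - m)) *
           (harm (q - 1) - harm (d - q - m)))"
proof -
  define x where "x S = a + (\<Sum>i\<in>S. of_nat M * w i)" for S
  define P where "P = Pow {1..d} - {{}}"
  define F where "F p = (\<Sum>S\<in>P. (- 1) ^ card S * (x S ^ p * L (x S)))" for p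
  have alt: "alt_subset_sum d (\<lambda>x. (a + x) ^ p * L (a + x)) (\<lambda>i. of_nat M * w i) = (- 1) ^ d * F p" for p
  proof -
    have "{S. S \<subseteq> {1..d} \<and> S \<noteq> {}} = P" by (auto simp: P_def)
    moreover have "(- 1 :: complex) ^ (d - card S) = (- 1) ^ d * (- 1) ^ card S" if "S \<in> P" for S
    proof -
      have "card S \<le> d" using that card_mono[of "{1..d}" S] by (auto simp: P_def)
      thus ?thesis by (simp add: power_diff field_simps flip: power_mult_distrib)
    qed
    ultimately show ?thesis
      unfolding alt_subset_sum_def F_def x_def sum_distrib_left
      by (intro sum.cong) (auto simp: mult.assoc)
  qed
  \<comment> \<open>The alternating sum over all corners is 0, and the empty corner contributes
    a^p.\<close>
  have pow: "(\<Sum>S\<in>P. (- 1) ^ card S * x S ^ p) = - (a ^ p)" if "p < d" for p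
  proof -
    have "0 = (\<Sum>S\<in>Pow {1..d}. (- 1) ^ card S * x S ^ p)"
      using that by (simp add: x_def alternating_power_sum_eq_0)
    also have "\<dots> = a ^ p + (\<Sum>S\<in>P. (- 1) ^ card S * x S ^ p)"
      unfolding P_def by (subst sum.remove[of _ "{}"]) (auto simp: x_def)
    finally show ?thesis by (simp add: eq_neg_iff_add_eq_0 add.commute)
  qed
  have coeff: "em_coeff d w m = (- 1) ^ d * (bernoullian_deriv0 d w m / fact m)" for m
    by (subst bernoullian_deriv0_conv_fps) 
       (use half_plane_nonzero[OF w] d_pos in \<open>auto simp: em_coeff_def\<close>)
  have "(\<Sum>S\<in>P. (- 1) ^ card S * (\<Sum>m<em_order. em_coeff d w m * kernel (d - q - m) (x S))) =
        (\<Sum>m=0..d - q. em_coeff d w m * (\<Sum>S\<in>P. (- 1) ^ card S * kernel (d - q - m) (x S)))"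
  proof -
    have "{..<em_order} = {0..d - q}" by (auto simp: em_order_def)
    thus ?thesis
      by (simp add: sum_distrib_left mult_ac) (rule sum.swap)
  qed
  also have "\<dots> = (\<Sum>m=0..d - q. (- 1) ^ q / fact (q - 1) * (bernoullian_deriv0 d w m / (fact m * fact (d - q - m)) * 
         ((- 1) ^ d * F (d - q - m))) +
       (- 1) ^ (d - q + 1) / fact (q - 1) * (bernoullian_deriv0 d w m * a ^ (d - q - m) / (fact m * fact (d - q - m)) *
           (harm (q - 1) - harm (d - q - m))))"
  proof (rule sum.cong[OF refl])
    fix m assume "m \<in> {0..d - q}"
    define p where "p = d - q - m"
    have p: "p < d" using q by (auto simp: p_def)
    define k :: complex where "k = (- 1) ^ (q - 1) / (fact (q - 1) * fact p)"
    have "(\<Sum>S\<in>P. (- 1) ^ card S * kernel p (x S)) = 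
            (\<Sum>S\<in>P. k * (harm p - harm (q - 1)) * ((- 1) ^ card S * x S ^ p) - k * ((- 1) ^ card S * (x S ^ p * L (x S))))"
      by (intro sum.cong refl) (simp add: kernel_def k_def field_simps)
    also have "\<dots> = k * (harm p - harm (q - 1)) * (- (a ^ p)) - k * F p"
      by (simp only: sum_subtractf flip: sum_distrib_left pow[OF p] F_def)
    finally have *: "(\<Sum>S\<in>P. (- 1) ^ card S * kernel p (x S)) = k * (harm p - harm (q - 1)) * (- (a ^ p)) - k * F p" .
    have sgn: "(- 1 :: complex) ^ q = - ((- 1) ^ (q - 1))" 
      using q by (cases q) auto
    have sgn': "(- 1 :: complex) ^ (d - q + 1) = (- 1) ^ d * (- 1) ^ (q - 1)"
    proof -
      have "d + (q - 1) = d - q + 1 + 2 * (q - 1)" using q by auto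
      hence "(- 1 :: complex) ^ (d + (q - 1)) = (- 1) ^ (d - q + 1 + 2 * (q - 1))" by (rule arg_cong)
      thus ?thesis by (simp add: power_add power_mult)
    qed
    show "em_coeff d w m * (\<Sum>S\<in>P. (- 1) ^ card S * kernel (d - q - m) (x S)) =
       (- 1) ^ q / fact (q - 1) * (bernoullian_deriv0 d w m / (fact m * fact (d - q - m)) * ((- 1) ^ d * F (d - q - m))) +
       (- 1) ^ (d - q + 1) / fact (q - 1) * (bernoullian_deriv0 d w m * a ^ (d - q - m) / (fact m * fact (d - q - m)) *
           (harm (q - 1) - harm (d - q - m)))"
      unfolding p_def[symmetric] * coeff sgn sgn' k_def by (simp add: field_simps)
  qed
  finally show ?thesis
    unfolding pole_approx_def P_def[symmetric] x_def[symmetric] alt sum.distrib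
    by (simp add: sum_distrib_left)
qed

end

theorem mainTheorem2:
  fixes \<theta> :: real and L :: "complex \<Rightarrow> complex"
    and d q :: nat and a :: complex and w :: "nat \<Rightarrow> complex"
  assumes "log_branch L \<theta>"
    and "1 \<le> d"
    and "a \<in> half_plane \<theta>"
    and "\<And>i. i \<in> {1..d} \<Longrightarrow> w i \<in> half_plane \<theta>"
    and "q \<in> {1..d}"
  defines "X \<equiv> (\<lambda>M::nat.
      (- 1) ^ q / fact (q - 1) *
        (\<Sum>m=0..d - q. bernoullian_deriv0 d w m / (fact m * fact (d - q - m)) *
           alt_subset_sum d (\<lambda>x. (a + x) ^ (d - q - m) * L (a + x)) (\<lambda>i. of_nat M * w i))
      + (\<Sum>n\<in>cube d (M - 1). branch_power L (a + multi_dot d n w) (- of_nat q)))"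
  shows "convergent X \<and>
    finite_part (barnes_zeta d w L a) (of_nat q) =
      lim X
      + (- 1) ^ (d - q + 1) / fact (q - 1) *
        (\<Sum>m=0..d - q. bernoullian_deriv0 d w m * a ^ (d - q - m) / (fact m * fact (d - q - m)) *
           (harm (q - 1) - harm (d - q - m)))"
proof -
  interpret barnes_pole \<theta> L d a w q
    by unfold_locales (use assms(1-5) in auto)
  define c where "c = (- 1) ^ (d - q + 1) / fact (q - 1) *
        (\<Sum>m=0..d - q. bernoullian_deriv0 d w m * a ^ (d - q - m) / (fact m * fact (d - q - m)) *
           (harm (q - 1) - harm (d - q - m)))"
  \<comment> \<open>\<open>X\<close> and \<open>pole_approx\<close> differ by a constant, so the
    convergence of \<open>X\<close> comes along with its limit.\<close>
  have "X = (\<lambda>M. pole_approx M - c)"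
    unfolding X_def pole_approx_eq c_def by simp
  hence "X \<longlonglongrightarrow> finite_part (barnes_zeta d w L a) (of_nat q) - c"
    by (simp only:) (intro tendsto_diff pole_approx_tendsto tendsto_const)
  thus ?thesis
    unfolding c_def[symmetric] by (auto simp: convergent_def dest: limI)
qed

end
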